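(* Let $\lambda\in P$ and $u\in\hat W^0$. Then: (1) $e^\lambda\bullet\psi^u=[\mathcal L_\lambda]\cup\psi^u$; (2) for $i\in I$, $y_i\bullet\psi^u=\psi^u$ and $s_i\bullet\psi^u=\psi^u$; (3) if $u\neq\mathrm{id}$, then $$y_0\bullet\psi^u=\psi^{us_0}=\sum_{\substack{(x_1,x_2)\in\hat W\times W\\ x_1*x_2=us_0}}(-1)^{\ell(x_1)+\ell(x_2)-\ell(u)-1}\,\theta(\psi^{x_1})\cup\eta(\psi^{x_2});$$ (4) if $u\neq\mathrm{id}$, then $$s_0\bullet\psi^u=e^{-\theta}\psi^u+\sum_{\substack{(x_1,x_2)\in\hat W\times W\\ x_1*x_2=us_0}}(-1)^{\ell(x_1)+\ell(x_2)-\ell(u)-1}\,\theta(\psi^{x_1})\cup\eta\big((1-e^{-\theta})\bullet\psi^{x_2}\big).$$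
   Context: $G$ is a complex semisimple simply-connected group with maximal torus $T$, weight lattice $P$, finite node set $I$, highest root $\theta$, maximal compact $K$, $T_{\mathbb R}=K\cap T$; $R(T)=\mathbb Z[P]$. $W$ is the finite Weyl group, $\hat W=Q^\vee\rtimes W$ the affine Weyl group with simple reflections $s_i$ ($i\in I\cup\{0\}$), acting on $R(T)$ at level zero ($s_0$ acts as $s_\theta$), with length $\ell$; $\hat W^0$ is the set of minimal-length coset representatives of $\hat W/W$. Demazure product $*$: associative with $s_i*v=s_iv$ if $s_iv>v$ and $v$ otherwise. Localization identifies $K_T^*(\hat{\mathrm{Fl}})$ with functions $\hat W\to R(T)$; the $K$-nilHecke ring $\hat{\mathbb K}$ (generated in $\mathrm{Frac}(R(T))\#\mathbb Q[\hat W]$ by $R(T)$ and $T_i=(1-e^{\alpha_i})^{-1}(s_i-1)$) pairs with it via $\langle\sum a_ww,\psi\rangle=\sum a_w\psi(w)$ and acts by $(a\bullet\psi)(b)=\langle ba,\psi\rangle$. $y_i:=1+T_i$. $\psi^w$ is the Schubert basis ($\langle T_v,\psi^w\rangle=\delta_{vw}$). $[\mathcal L_\lambda]$ is the line bundle class with $[\mathcal L_\lambda](t_\mu v)=e^{v\lambda}$. $\theta$ (as an operator) is the pullback along $LK/T_{\mathbb R}\to LK/K\simeq\Omega K\hookrightarrow LK\to LK/T_{\mathbb R}$, and $\eta$ the pullback along $LK/T_{\mathbb R}\xrightarrow{\mathrm{ev}_1}K/T_{\mathbb R}\hookrightarrow LK/T_{\mathbb R}$ (evaluation at the identity, then inclusion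 of constant loops). In (4), $e^{-\theta}$ denotes the character of the negative highest root.
   Formalization: In (4) the term e^{-θ}ψ^u is taken as e^{-θ}•ψ^u (= [L_{-θ}]∪ψ^u), since plain multiplication by e^{-θ} fails already for SL_2, u = s_0; G is taken simple so that θ and s_0 are defined; the operators θ, η are given by their values at T-fixed points. *)

theory Defs
  imports "HOL-Library.Poly_Mapping" "HOL-Computational_Algebra.Fraction_Field" Complex_Main
begin

text \<open>The node set I is a finite type 'n (the linorder class is only a technical device
 making Z[P] an integral domain in the library).  Weights P are written in the basis of
 fundamental weights, coroots Q^vee in the basis of simple coroots; both are 'n =>0 int.
 Since G is simply connected, P = Hom(Q^vee, Z) with the pairing below.\<close>

type_synonym 'n lat = "'n \<Rightarrow>\<^sub>0 int"
type_synonym 'n rep = "'n lat \<Rightarrow>\<^sub>0 int"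
type_synonym 'n frac = "'n rep fract"
type_synonym 'n aff = "('n lat \<Rightarrow> 'n lat) \<times> ('n lat \<Rightarrow> 'n lat) \<times> 'n lat"
  (* (level-zero action on P, linear action on Q^vee, translation part in Q^vee) *)

definition lsc :: "int \<Rightarrow> 'n::{finite,linorder} lat \<Rightarrow> 'n lat" where
  "lsc c v = (\<Sum>k\<in>UNIV. Poly_Mapping.single k (c * Poly_Mapping.lookup v k))"

definition lpair :: "'n::{finite,linorder} lat \<Rightarrow> 'n lat \<Rightarrow> int" where
  "lpair \<mu> la = (\<Sum>i\<in>UNIV. Poly_Mapping.lookup \<mu> i * Poly_Mapping.lookup la i)"

definition unitv :: "'n::{finite,linorder} \<Rightarrow> 'n lat" where
  "unitv i = Poly_Mapping.single i 1"

definition echar :: "'n::{finite,linorder} lat \<Rightarrow> 'n rep" where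
  "echar la = Poly_Mapping.single la 1"

definition fr :: "'n::{finite,linorder} rep \<Rightarrow> 'n frac" where
  "fr r = Fraction_Field.Fract r 1"

definition cartan_finite :: "('n::{finite,linorder} \<Rightarrow> 'n \<Rightarrow> int) \<Rightarrow> bool" where
  "cartan_finite A \<longleftrightarrow> (\<forall>i. A i i = 2) \<and> (\<forall>i j. i \<noteq> j \<longrightarrow> A i j \<le> 0)
     \<and> (\<forall>i j. A i j = 0 \<longleftrightarrow> A j i = 0)
     \<and> (\<exists>d::'n \<Rightarrow> real. (\<forall>i. d i > 0) \<and> (\<forall>i j. d i * A i j = d j * A j i)
          \<and> (\<forall>x::'n \<Rightarrow> real. (\<exists>i. x i \<noteq> 0) \<longrightarrow> (\<Sum>i\<in>UNIV. \<Sum>j\<in>UNIV. x i * d i * A i j * x j) > 0))"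

definition indecomposable :: "('n \<Rightarrow> 'n \<Rightarrow> int) \<Rightarrow> bool" where
  "indecomposable A \<longleftrightarrow> (\<forall>J. J \<noteq> {} \<and> J \<noteq> UNIV \<longrightarrow> (\<exists>i\<in>J. \<exists>j. j \<notin> J \<and> A i j \<noteq> 0))"

text \<open>Kac convention: A i j = <alpha_i^vee, alpha_j>.  So alpha_j has fundamental-weight
 coordinates (A i j)_i, and <mu, alpha_j> = sum_i mu_i A i j for mu in Q^vee.\<close>

definition alpha :: "('n::{finite,linorder} \<Rightarrow> 'n \<Rightarrow> int) \<Rightarrow> 'n \<Rightarrow> 'n lat" where
  "alpha A j = (\<Sum>i\<in>UNIV. Poly_Mapping.single i (A i j))"

definition amult :: "'n aff \<Rightarrow> 'n aff \<Rightarrow> 'n aff" where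
  "amult x y = (case x of (a, b, \<mu>) \<Rightarrow> case y of (a', b', \<nu>) \<Rightarrow> (a \<circ> a', b \<circ> b', \<mu> + b \<nu>))"

definition aone :: "'n aff" where
  "aone = (id, id, 0)"

definition sgen :: "('n::{finite,linorder} \<Rightarrow> 'n \<Rightarrow> int) \<Rightarrow> 'n \<Rightarrow> 'n aff" where
  "sgen A i = ((\<lambda>la. la - lsc (Poly_Mapping.lookup la i) (alpha A i)),
               (\<lambda>\<mu>. \<mu> - lsc (lpair \<mu> (alpha A i)) (unitv i)), 0)"

inductive_set weylW :: "('n::{finite,linorder} \<Rightarrow> 'n \<Rightarrow> int) \<Rightarrow> 'n aff set" for A where
  one: "aone \<in> weylW A"
| step: "w \<in> weylW A \<Longrightarrow> amult w (sgen A i) \<in> weylW A"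

definition roots :: "('n::{finite,linorder} \<Rightarrow> 'n \<Rightarrow> int) \<Rightarrow> 'n lat set" where
  "roots A = {fst w (alpha A i) | w i. w \<in> weylW A}"

definition highest_root :: "('n::{finite,linorder} \<Rightarrow> 'n \<Rightarrow> int) \<Rightarrow> 'n lat" where
  "highest_root A = (THE \<theta>. \<theta> \<in> roots A \<and>
      (\<forall>\<beta>\<in>roots A. \<exists>c::'n \<Rightarrow> nat. \<theta> - \<beta> = (\<Sum>i\<in>UNIV. lsc (int (c i)) (alpha A i))))"

definition coroot :: "('n::{finite,linorder} \<Rightarrow> 'n \<Rightarrow> int) \<Rightarrow> 'n lat \<Rightarrow> 'n lat" where
  "coroot A \<beta> = (SOME c. \<exists>w\<in>weylW A. \<exists>i. fst w (alpha A i) = \<beta> \<and> fst (snd w) (unitv i) = c)"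

text \<open>s_0 = t_{theta^vee} s_theta; at level zero it acts on P as s_theta.\<close>
definition szero :: "('n::{finite,linorder} \<Rightarrow> 'n \<Rightarrow> int) \<Rightarrow> 'n aff" where
  "szero A = (let \<theta> = highest_root A; \<theta>v = coroot A \<theta> in
      ((\<lambda>la. la - lsc (lpair \<theta>v la) \<theta>), (\<lambda>\<mu>. \<mu> - lsc (lpair \<mu> \<theta>) \<theta>v), \<theta>v))"

definition agen :: "('n::{finite,linorder} \<Rightarrow> 'n \<Rightarrow> int) \<Rightarrow> 'n option \<Rightarrow> 'n aff" where
  "agen A j = (case j of None \<Rightarrow> szero A | Some i \<Rightarrow> sgen A i)"

text \<open>Level-zero simple roots: alpha_0 acts as -theta.\<close>
definition aalpha :: "('n::{finite,linorder} \<Rightarrow> 'n \<Rightarrow> int) \<Rightarrow> 'n option \<Rightarrow> 'n lat" where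
  "aalpha A j = (case j of None \<Rightarrow> - highest_root A | Some i \<Rightarrow> alpha A i)"

inductive_set affW :: "('n::{finite,linorder} \<Rightarrow> 'n \<Rightarrow> int) \<Rightarrow> 'n aff set" for A where
  one: "aone \<in> affW A"
| step: "w \<in> affW A \<Longrightarrow> amult w (agen A j) \<in> affW A"

definition wordprod :: "('n::{finite,linorder} \<Rightarrow> 'n \<Rightarrow> int) \<Rightarrow> 'n option list \<Rightarrow> 'n aff" where
  "wordprod A ws = foldr (\<lambda>j x. amult (agen A j) x) ws aone"

definition len :: "('n::{finite,linorder} \<Rightarrow> 'n \<Rightarrow> int) \<Rightarrow> 'n aff \<Rightarrow> nat" where
  "len A x = (LEAST k. \<exists>ws. length ws = k \<and> wordprod A ws = x)"

definition redword :: "('n::{finite,linorder} \<Rightarrow> 'n \<Rightarrow> int) \<Rightarrow> 'n aff \<Rightarrow> 'n option list" where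
  "redword A x = (SOME ws. wordprod A ws = x \<and> length ws = len A x)"

definition demazure :: "('n::{finite,linorder} \<Rightarrow> 'n \<Rightarrow> int) \<Rightarrow> 'n aff \<Rightarrow> 'n aff \<Rightarrow> 'n aff" where
  "demazure A x y = foldr (\<lambda>j v. if len A v < len A (amult (agen A j) v) then amult (agen A j) v else v)
                          (redword A x) y"

definition affW0 :: "('n::{finite,linorder} \<Rightarrow> 'n \<Rightarrow> int) \<Rightarrow> 'n aff set" where
  "affW0 A = {x \<in> affW A. \<forall>w\<in>weylW A. len A x \<le> len A (amult x w)}"

definition actR :: "'n::{finite,linorder} aff \<Rightarrow> 'n rep \<Rightarrow> 'n rep" where
  "actR x f = (\<Sum>la\<in>Poly_Mapping.keys f. Poly_Mapping.single (fst x la) (Poly_Mapping.lookup f la))"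

text \<open>Functions affW -> Frac(R(T)); (a . psi)(b) = <b a, psi>.\<close>

definition eact :: "'n::{finite,linorder} rep \<Rightarrow> ('n aff \<Rightarrow> 'n frac) \<Rightarrow> ('n aff \<Rightarrow> 'n frac)" where
  "eact f \<psi> = (\<lambda>b. fr (actR b f) * \<psi> b)"

definition sact :: "('n::{finite,linorder} \<Rightarrow> 'n \<Rightarrow> int) \<Rightarrow> 'n option \<Rightarrow> ('n aff \<Rightarrow> 'n frac) \<Rightarrow> ('n aff \<Rightarrow> 'n frac)" where
  "sact A j \<psi> = (\<lambda>b. \<psi> (amult b (agen A j)))"

definition Tact :: "('n::{finite,linorder} \<Rightarrow> 'n \<Rightarrow> int) \<Rightarrow> 'n option \<Rightarrow> ('n aff \<Rightarrow> 'n frac) \<Rightarrow> ('n aff \<Rightarrow> 'n frac)" where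
  "Tact A j \<psi> = (\<lambda>b. (\<psi> (amult b (agen A j)) - \<psi> b) / fr (1 - echar (fst b (aalpha A j))))"

definition yact :: "('n::{finite,linorder} \<Rightarrow> 'n \<Rightarrow> int) \<Rightarrow> 'n option \<Rightarrow> ('n aff \<Rightarrow> 'n frac) \<Rightarrow> ('n aff \<Rightarrow> 'n frac)" where
  "yact A j \<psi> = (\<lambda>b. \<psi> b + Tact A j \<psi> b)"

definition pairT :: "('n::{finite,linorder} \<Rightarrow> 'n \<Rightarrow> int) \<Rightarrow> 'n aff \<Rightarrow> ('n aff \<Rightarrow> 'n frac) \<Rightarrow> 'n frac" where
  "pairT A v \<psi> = foldr (Tact A) (redword A v) \<psi> aone"

definition schub :: "('n::{finite,linorder} \<Rightarrow> 'n \<Rightarrow> int) \<Rightarrow> 'n aff \<Rightarrow> ('n aff \<Rightarrow> 'n frac)" where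
  "schub A w = (THE \<psi>. (\<forall>b. b \<notin> affW A \<longrightarrow> \<psi> b = 0) \<and>
                        (\<forall>v\<in>affW A. pairT A v \<psi> = (if v = w then 1 else 0)))"

definition lineb :: "'n::{finite,linorder} lat \<Rightarrow> ('n aff \<Rightarrow> 'n frac)" where   (* [L_lambda](t_mu v) = e^{v lambda} *)
  "lineb la = (\<lambda>b. fr (echar (fst b la)))"

text \<open>theta and eta on localizations: (theta psi)(t_mu v) = psi(t_mu), (eta psi)(t_mu v) = psi(v).\<close>
definition thetaOp :: "('n::{finite,linorder} aff \<Rightarrow> 'n frac) \<Rightarrow> ('n aff \<Rightarrow> 'n frac)" where
  "thetaOp \<psi> = (\<lambda>b. \<psi> (id, id, snd (snd b)))"

definition etaOp :: "('n::{finite,linorder} aff \<Rightarrow> 'n frac) \<Rightarrow> ('n aff \<Rightarrow> 'n frac)" where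
  "etaOp \<psi> = (\<lambda>b. \<psi> (fst b, fst (snd b), 0))"

end

theory Submission
  imports Defs
begin

text \<open>
  For a reduced word of \<open>v\<close> the operator \<open>T\<^sub>v\<close> involves only the values at elements of length at most
  \<open>\<ell>(v)\<close>, with nonzero coefficient at \<open>v\<close>. By this triangularity the dual family \<open>\<psi>\<^sup>w\<close> exists, is
  unique, and every function satisfies \<open>f(v) = \<Sum> \<langle>T\<^sub>y, f\<rangle> \<psi>\<^sup>y(v)\<close>. Since \<open>T\<^sub>v\<close> does not depend on the
  reduced word and \<open>T\<^sub>j\<close> squares to \<open>- T\<^sub>j\<close>, one has \<open>T\<^sub>x T\<^sub>y = \<plusminus> T\<^bsub>x*y\<^esub>\<close>, and \<open>T\<^sub>j \<psi>\<^sup>u\<close> is either zero or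
  \<open>\<psi>\<^bsub>u s\<^sub>j\<^esub> - \<psi>\<^sup>u\<close>; this gives (2) and the first half of (3). Expanding \<open>\<psi>\<^sup>w(t v)\<close> twice, first in \<open>v\<close>
  and then in the translation \<open>t\<close>, which acts trivially on coefficients, gives the sum in (3).

  Independence of the reduced word is Matsumoto's theorem together with the braid relations. The
  latter follow from expanding \<open>f(b s\<^sub>i s\<^sub>j \<dots>) = f(b s\<^sub>j s\<^sub>i \<dots>)\<close> in the \<open>T\<close>-words at \<open>b\<close>: the coefficients of
  all shorter words agree by a polynomial (Yang-Baxter) identity, hence so do the two longest words.
  The Coxeter combinatorics is obtained from the action on root coordinates, where an element has
  \<open>j\<close> as a descent iff it makes the \<open>j\<close>-th simple root negative.
\<close>

section \<open>Words in the simple reflections of a generalized Cartan matrix\<close>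

definition simple_root :: "'j \<Rightarrow> 'j \<Rightarrow> int" where
  "simple_root i = (\<lambda>k. if k = i then 1 else 0)"

definition coroot_eval :: "('j::finite \<Rightarrow> 'j \<Rightarrow> int) \<Rightarrow> 'j \<Rightarrow> ('j \<Rightarrow> int) \<Rightarrow> int" where
  "coroot_eval C i f = (\<Sum>k\<in>UNIV. C i k * f k)"

definition simple_refl :: "('j::finite \<Rightarrow> 'j \<Rightarrow> int) \<Rightarrow> 'j \<Rightarrow> ('j \<Rightarrow> int) \<Rightarrow> ('j \<Rightarrow> int)" where
  "simple_refl C i f = f(i := f i - coroot_eval C i f)"

abbreviation word_act :: "('j::finite \<Rightarrow> 'j \<Rightarrow> int) \<Rightarrow> 'j list \<Rightarrow> ('j \<Rightarrow> int) \<Rightarrow> ('j \<Rightarrow> int)" where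
  "word_act C ws \<equiv> foldr (simple_refl C) ws"

definition nonneg :: "('j \<Rightarrow> int) \<Rightarrow> bool" where
  "nonneg f \<longleftrightarrow> (\<forall>k. f k \<ge> 0)"

lemma sum_fun_upd:
  fixes c f :: "'j::finite \<Rightarrow> int"
  shows "(\<Sum>k\<in>UNIV. c k * (f(i := v)) k) = (\<Sum>k\<in>UNIV. c k * f k) + c i * (v - f i)"
proof -
  have "(\<Sum>k\<in>UNIV. c k * (f(i := v)) k) - (\<Sum>k\<in>UNIV. c k * f k)
      = (\<Sum>k\<in>UNIV. if k = i then c i * (v - f i) else 0)"
    unfolding sum_subtractf[symmetric] by (intro sum.cong) (auto simp: algebra_simps)
  then show ?thesis by simp
qed

lemma coroot_eval_upd: "coroot_eval C i (f(j := v)) = coroot_eval C i f + C i j * (v - f j)"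
  unfolding coroot_eval_def by (rule sum_fun_upd)

lemma coroot_eval_linear:
  "coroot_eval C i (\<lambda>x. p * f x + q * g x) = p * coroot_eval C i f + q * coroot_eval C i g"
  by (simp add: coroot_eval_def sum.distrib sum_distrib_left algebra_simps)

lemma coroot_eval_diff: "coroot_eval C i (\<lambda>x. f x - g x) = coroot_eval C i f - coroot_eval C i g"
  using coroot_eval_linear[of C i 1 f "-1" g] by simp

lemma coroot_eval_simple_root [simp]: "coroot_eval C i (simple_root j) = C i j"
  by (simp add: coroot_eval_def simple_root_def if_distrib[of "\<lambda>x. _ * x"] cong: if_cong)

lemma simple_refl_linear:
  "simple_refl C i (\<lambda>x. p * f x + q * g x) = (\<lambda>x. p * simple_refl C i f x + q * simple_refl C i g x)"
  by (auto simp: simple_refl_def coroot_eval_linear algebra_simps)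

lemma simple_refl_eq: "simple_refl C i f = (\<lambda>x. f x - coroot_eval C i f * simple_root i x)"
  by (auto simp: simple_refl_def simple_root_def)

lemma word_act_linear:
  "word_act C ws (\<lambda>x. p * f x + q * g x) = (\<lambda>x. p * word_act C ws f x + q * word_act C ws g x)"
  by (induction ws) (simp_all add: simple_refl_linear)

lemma word_act_uminus: "word_act C ws (\<lambda>x. - f x) = (\<lambda>x. - word_act C ws f x)"
  using word_act_linear[of C ws "-1" f 0 f] by simp

lemma word_act_diff: "word_act C ws (\<lambda>x. f x - p * g x) = (\<lambda>x. word_act C ws f x - p * word_act C ws g x)"
  using word_act_linear[of C ws 1 f "-p" g] by simp

lemma word_act_zero: "word_act C ws (\<lambda>x. 0) = (\<lambda>x. 0)"
  using word_act_linear[of C ws 0 undefined 0 undefined] by simp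

lemma word_act_append_cong: "word_act C xs = word_act C ys \<Longrightarrow> word_act C (xs @ zs) = word_act C (ys @ zs)"
  by (simp add: fun_eq_iff)

fun alt :: "'j \<Rightarrow> 'j \<Rightarrow> nat \<Rightarrow> 'j list" where
  "alt i j 0 = []"
| "alt i j (Suc k) = i # alt j i k"

lemma length_alt [simp]: "length (alt i j k) = k"
  by (induction k arbitrary: i j) auto

lemma alt_Suc_snoc: "alt i j (Suc k) = alt i j k @ [if even k then i else j]"
proof (induction k arbitrary: i j)
  case (Suc k)
  have "alt i j (Suc (Suc k)) = i # alt j i (Suc k)" by simp
  also have "\<dots> = i # alt j i k @ [if even k then j else i]" unfolding Suc ..
  finally show ?case by simp
qed simp

lemma take_alt: "n \<le> k \<Longrightarrow> take n (alt i j k) = alt i j n"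
proof (induction n arbitrary: i j k)
  case (Suc n)
  then show ?case by (cases k) auto
qed simp

lemma rev_alt: "rev (alt i j k) = (if even k then alt j i k else alt i j k)"
proof (induction k arbitrary: i j)
  case (Suc k)
  have "rev (alt i j (Suc k)) = (if even k then i else j) # rev (alt i j k)"
    by (simp only: alt_Suc_snoc) simp
  then show ?case unfolding Suc by (simp del: alt.simps add: alt.simps(2))
qed simp

definition root_comb :: "'j \<Rightarrow> 'j \<Rightarrow> int \<Rightarrow> int \<Rightarrow> 'j \<Rightarrow> int" where
  "root_comb i j p q = (\<lambda>x. p * simple_root i x + q * simple_root j x)"

lemma root_comb_commute: "root_comb i j p q = root_comb j i q p"
  by (simp add: root_comb_def add.commute)

lemma word_act_root_comb:
  "word_act C ws (root_comb i j p q) = (\<lambda>x. p * word_act C ws (simple_root i) x + q * word_act C ws (simple_root j) x)"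
  unfolding root_comb_def by (rule word_act_linear)

locale generalized_cartan =
  fixes C :: "'j::finite \<Rightarrow> 'j \<Rightarrow> int"
  assumes diag [simp]: "C i i = 2"
    and offdiag_nonpos: "i \<noteq> j \<Longrightarrow> C i j \<le> 0"
    and zero_sym: "C i j = 0 \<longleftrightarrow> C j i = 0"
begin

subsection \<open>Length\<close>

definition word_len :: "'j list \<Rightarrow> nat" where
  "word_len ws = (LEAST n. \<exists>us. length us = n \<and> word_act C us = word_act C ws)"

definition reduced :: "'j list \<Rightarrow> bool" where
  "reduced ws \<longleftrightarrow> word_len ws = length ws"

lemma simple_refl_simple_refl [simp]: "simple_refl C i (simple_refl C i f) = f"
  by (simp add: simple_refl_def coroot_eval_upd)

lemma word_act_rev_cancel [simp]:
  "word_act C (rev ws) (word_act C ws f) = f" "word_act C ws (word_act C (rev ws) f) = f"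
proof -
  show cancel: "word_act C (rev ws) (word_act C ws f) = f" for ws f
    by (induction ws arbitrary: f) auto
  show "word_act C ws (word_act C (rev ws) f) = f" using cancel[of "rev ws" f] by simp
qed

lemma word_act_append_eq_iff: "word_act C (xs @ zs) = word_act C (ys @ zs) \<longleftrightarrow> word_act C xs = word_act C ys"
proof
  assume eq: "word_act C (xs @ zs) = word_act C (ys @ zs)"
  show "word_act C xs = word_act C ys"
  proof
    fix f show "word_act C xs f = word_act C ys f"
      using fun_cong[OF eq, of "word_act C (rev zs) f"] by simp
  qed
qed (rule word_act_append_cong)

lemma word_act_rev_cong:
  assumes "word_act C us = word_act C ws"
  shows "word_act C (rev us) = word_act C (rev ws)"
proof
  fix f
  have "word_act C (rev us) f = word_act C (rev us) (word_act C ws (word_act C (rev ws) f))" by simp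
  then show "word_act C (rev us) f = word_act C (rev ws) f" by (simp flip: assms)
qed

lemma word_len_le: "word_act C us = word_act C ws \<Longrightarrow> word_len ws \<le> length us"
  unfolding word_len_def by (rule Least_le) auto

lemma word_len_le_length: "word_len ws \<le> length ws"
  by (rule word_len_le) (rule refl)

lemma ex_reduced_word: "\<exists>us. word_act C us = word_act C ws \<and> length us = word_len ws"
  unfolding word_len_def by (rule LeastI2_ex) auto

lemma word_len_cong: "word_act C us = word_act C ws \<Longrightarrow> word_len us = word_len ws"
  unfolding word_len_def by simp

lemma word_len_append_le: "word_len (ws @ vs) \<le> word_len ws + length vs"
proof -
  obtain us where "word_act C us = word_act C ws" "length us = word_len ws" using ex_reduced_word by blast
  then show ?thesis using word_len_le[of "us @ vs" "ws @ vs", OF word_act_append_cong] by simp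
qed

lemma word_len_le_append: "word_len ws \<le> word_len (ws @ vs) + length vs"
proof -
  have "word_len ws = word_len ((ws @ vs) @ rev vs)" by (intro word_len_cong) (simp add: fun_eq_iff)
  then show ?thesis using word_len_append_le[of "ws @ vs" "rev vs"] by simp
qed

lemma word_len_square_cancel [simp]: "word_len (ws @ [j, j]) = word_len ws"
  by (intro word_len_cong) (simp add: fun_eq_iff)

lemma word_len_rev: "word_len (rev ws) = word_len ws"
proof -
  have "word_len (rev ws) \<le> word_len ws" for ws
  proof -
    obtain us where us: "word_act C us = word_act C ws" "length us = word_len ws" using ex_reduced_word by blast
    then show ?thesis using word_len_le[OF word_act_rev_cong[OF us(1)]] by simp
  qed
  from this[of ws] this[of "rev ws"] show ?thesis by simp
qed

lemma reduced_appendD: "reduced (ws @ vs) \<Longrightarrow> reduced ws"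
  unfolding reduced_def using word_len_le_length[of ws] word_len_append_le[of ws vs] by simp

lemma reduced_length_eq:
  "word_act C us = word_act C ws \<Longrightarrow> reduced us \<Longrightarrow> reduced ws \<Longrightarrow> length us = length ws"
  using word_len_cong[of us ws] by (simp add: reduced_def)

lemma reduced_snoc_descent: "reduced (ws @ [j]) \<Longrightarrow> word_len (ws @ [j, j]) < word_len (ws @ [j])"
  using word_len_le_length[of ws] by (simp add: reduced_def)

lemma ex_right_descent:
  assumes "word_len ws \<noteq> 0"
  obtains i where "Suc (word_len (ws @ [i])) = word_len ws"
proof -
  obtain us where us: "word_act C us = word_act C ws" "length us = word_len ws" using ex_reduced_word by blast
  then obtain us' i where us': "us = us' @ [i]" using assms by (cases us rule: rev_cases) auto
  have "word_act C (ws @ [i]) = word_act C ((us' @ [i]) @ [i])"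
    using us(1) us' by (intro word_act_append_cong) simp
  also have "\<dots> = word_act C us'" by (simp add: fun_eq_iff)
  finally have "word_len (ws @ [i]) \<le> length us'" using word_len_le[of us' "ws @ [i]"] by simp
  moreover have "word_len ws \<le> word_len (ws @ [i]) + 1" using word_len_le_append[of ws "[i]"] by simp
  ultimately show ?thesis using us(2) us' that[of i] by simp
qed

definition cancels :: "'j list \<Rightarrow> 'j list \<Rightarrow> bool" where
  "cancels ws us \<longleftrightarrow> word_len (ws @ us) + length us = word_len ws"

lemma cancels_appendD:
  assumes "cancels ws (us @ vs)"
  shows "cancels ws us"
  using assms word_len_le_append[of "ws @ us" vs] word_len_le_append[of ws us]
  by (simp add: cancels_def)

lemma cancels_snocI:
  assumes "cancels ws us" "word_len (ws @ us @ [j]) < word_len (ws @ us)"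
  shows "cancels ws (us @ [j])"
  using assms word_len_le_append[of "ws @ us" "[j]"] by (simp add: cancels_def)

lemma cancels_alt_mono: "cancels ws (alt i j k) \<Longrightarrow> n \<le> k \<Longrightarrow> cancels ws (alt i j n)"
  by (metis append_take_drop_id cancels_appendD take_alt)

subsection \<open>Rank two\<close>

text \<open>The order of \<open>s\<^sub>i s\<^sub>j\<close>, with 0 standing for infinite order.\<close>

definition braid_order :: "'j \<Rightarrow> 'j \<Rightarrow> nat" where
  "braid_order i j = (let p = C i j * C j i in
     if p = 0 then 2 else if p = 1 then 3 else if p = 2 then 4 else if p = 3 then 6 else 0)"

lemma braid_order_sym: "braid_order i j = braid_order j i"
  by (simp add: braid_order_def mult.commute)

lemma finite_braid_order_cases:
  assumes "i \<noteq> j" "braid_order i j \<noteq> 0"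
  shows "(C i j, C j i) \<in> {(0,0), (-1,-1), (-1,-2), (-2,-1), (-1,-3), (-3,-1)}"
proof (cases "C i j = 0")
  case True
  then show ?thesis using zero_sym[of i j] by simp
next
  case False
  define a b where "a = - C i j" and "b = - C j i"
  have pos: "a \<ge> 1" "b \<ge> 1"
    using False zero_sym[of i j] offdiag_nonpos[of i j] offdiag_nonpos[of j i] assms(1) by (auto simp: a_def b_def)
  have "a * b \<le> 3" using assms(2) by (auto simp: braid_order_def a_def b_def Let_def split: if_splits)
  moreover have "a * 1 \<le> a * b" "1 * b \<le> a * b" using pos by (auto intro: mult_left_mono mult_right_mono)
  ultimately have "a \<le> 3" "b \<le> 3" by linarith+
  with pos have "a = 1 \<or> a = 2 \<or> a = 3" "b = 1 \<or> b = 2 \<or> b = 3" by linarith+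
  then have "(a, b) \<in> {(1,1), (1,2), (2,1), (1,3), (3,1)}" using \<open>a * b \<le> 3\<close> by auto
  then show ?thesis unfolding a_def b_def by auto
qed

lemma infinite_braid_order_prod:
  assumes "i \<noteq> j" "braid_order i j = 0"
  shows "4 \<le> C i j * C j i"
proof -
  have "0 \<le> C i j * C j i" using offdiag_nonpos[of i j] offdiag_nonpos[of j i] assms(1)
    by (simp add: mult_nonpos_nonpos)
  moreover have "C i j * C j i \<noteq> 0" "C i j * C j i \<noteq> 1" "C i j * C j i \<noteq> 2" "C i j * C j i \<noteq> 3"
    using assms(2) by (auto simp: braid_order_def Let_def split: if_splits)
  ultimately show ?thesis by linarith
qed

lemma simple_refl_root_comb:
  assumes "i \<noteq> j"
  shows "simple_refl C i (root_comb i j p q) = root_comb i j (- p - C i j * q) q"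
    and "simple_refl C j (root_comb i j p q) = root_comb i j p (- q - C j i * p)"
  using assms unfolding root_comb_def simple_refl_def coroot_eval_linear coroot_eval_simple_root
  by (auto simp: simple_root_def fun_eq_iff)

definition alt_root :: "'j \<Rightarrow> 'j \<Rightarrow> nat \<Rightarrow> 'j \<Rightarrow> int" where
  "alt_root i j k = word_act C (rev (alt i j k)) (simple_root j)"

lemma alt_root_0: "alt_root i j 0 = root_comb i j 0 1"
  by (simp add: alt_root_def root_comb_def)

lemma alt_root_Suc: "alt_root i j (Suc k) = simple_refl C (if even k then i else j) (alt_root i j k)"
  unfolding alt_root_def alt_Suc_snoc by simp

lemma alt_root_nonneg_infinite:
  assumes "i \<noteq> j" "4 \<le> C i j * C j i"
  shows "\<exists>p q. p \<ge> 0 \<and> q \<ge> 0 \<and> (if even k then 2 * p \<le> - C i j * q else 2 * q \<le> - C j i * p)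
    \<and> alt_root i j k = root_comb i j p q"
proof (induction k)
  case 0
  show ?case using offdiag_nonpos[OF assms(1)] by (intro exI[of _ 0] exI[of _ 1]) (simp add: alt_root_0)
next
  case (Suc k)
  have next_le: "2 * q \<le> - c * (- p - a * q)" "0 \<le> - p - a * q"
    if "0 \<le> p" "0 \<le> q" "2 * p \<le> - a * q" "c \<le> 0" "4 \<le> a * c" for a c p q :: int
  proof -
    show "0 \<le> - p - a * q" using that by simp
    have "c * (- a * q) \<le> c * (2 * p)" using that by (intro mult_left_mono_neg)
    moreover have "4 * q \<le> (a * c) * q" using that by (intro mult_right_mono)
    ultimately show "2 * q \<le> - c * (- p - a * q)" by (simp add: algebra_simps)
  qed
  have nonpos: "C i j \<le> 0" "C j i \<le> 0" using offdiag_nonpos assms(1) by auto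
  obtain p q where pq: "p \<ge> 0" "q \<ge> 0" "if even k then 2 * p \<le> - C i j * q else 2 * q \<le> - C j i * p"
    "alt_root i j k = root_comb i j p q" using Suc.IH by blast
  show ?case
  proof (cases "even k")
    case True
    then show ?thesis using pq next_le[of p q "C i j" "C j i"] nonpos assms
      by (intro exI[of _ "- p - C i j * q"] exI[of _ q]) (simp add: alt_root_Suc simple_refl_root_comb)
  next
    case False
    then show ?thesis using pq next_le[of q p "C j i" "C i j"] nonpos assms
      by (intro exI[of _ p] exI[of _ "- q - C j i * p"]) (simp add: alt_root_Suc simple_refl_root_comb mult.commute)
  qed
qed

lemma alt_root_nonneg:
  assumes "i \<noteq> j" and "braid_order i j = 0 \<or> k < braid_order i j"
  obtains p q where "p \<ge> 0" "q \<ge> 0" "alt_root i j k = root_comb i j p q"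
proof (cases "braid_order i j = 0")
  case True
  then show thesis using alt_root_nonneg_infinite[OF assms(1), of k] infinite_braid_order_prod[OF assms(1)] that
    by blast
next
  case False
  have combI: "\<exists>p'\<ge>0. \<exists>q'\<ge>0. root_comb i j p q = root_comb i j p' q'" if "p \<ge> 0" "q \<ge> 0" for p q
    using that by blast
  have "k < braid_order i j" using assms(2) False by auto
  moreover have "braid_order i j \<le> 6" by (simp add: braid_order_def Let_def)
  ultimately have "k \<in> {0,1,2,3,4,5}" by auto
  then have "\<exists>p\<ge>0. \<exists>q\<ge>0. alt_root i j k = root_comb i j p q"
    using \<open>k < braid_order i j\<close> finite_braid_order_cases[OF assms(1) False]
    by (auto simp: braid_order_def eval_nat_numeral alt_root_0 alt_root_Suc simple_refl_root_comb[OF assms(1)])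
       (rule combI; simp)+
  then show thesis using that by blast
qed

text \<open>Both sides of a braid relation change only the coordinates \<open>i\<close> and \<open>j\<close>, by amounts that depend on \<open>f\<close>
  only through its values on the two coroots.\<close>

lemma word_act_braid:
  assumes "i \<noteq> j"
  shows "word_act C (alt i j (braid_order i j)) = word_act C (alt j i (braid_order i j))"
proof (cases "braid_order i j = 0")
  case False
  define shift where "shift f P Q = f(i := f i - P, j := f j - Q)" for f :: "'j \<Rightarrow> int" and P Q
  have refl_shift: "simple_refl C i (shift f P Q) = shift f (coroot_eval C i f - P - C i j * Q) Q"
    "simple_refl C j (shift f P Q) = shift f P (coroot_eval C j f - Q - C j i * P)" for f P Q
    using assms by (auto simp: shift_def simple_refl_def coroot_eval_upd fun_eq_iff)
  show ?thesis
  proof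
    fix f
    have shift_0: "f = shift f 0 0" by (simp add: shift_def)
    show "word_act C (alt i j (braid_order i j)) f = word_act C (alt j i (braid_order i j)) f"
      using finite_braid_order_cases[OF assms False]
      by (subst (1 2) shift_0) (auto simp: braid_order_def eval_nat_numeral refl_shift add.commute)
  qed
qed simp

subsection \<open>Ascents and positive roots\<close>

lemma maximal_cancelling_alt:
  assumes "Suc (word_len (ws @ [i])) = word_len ws"
  obtains k where "1 \<le> k" "cancels ws (alt i j k)"
    "\<And>n. n \<in> {i, j} \<Longrightarrow> word_len (ws @ alt i j k) \<le> word_len (ws @ alt i j k @ [n])"
proof -
  have "cancels ws (alt i j (Suc 0))" using assms by (simp add: cancels_def)
  moreover have "\<not> cancels ws (alt i j (Suc (word_len ws)))" unfolding cancels_def length_alt by linarith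
  ultimately obtain k where k: "\<not> cancels ws (alt i j (Suc k))" "\<And>l. l < k \<Longrightarrow> cancels ws (alt i j (Suc l))" "k \<noteq> 0"
    using ex_least_nat_le[of "\<lambda>k. \<not> cancels ws (alt i j (Suc k))"] by (metis not_gr_zero)
  define n where "n = (if even k then i else j)"
  define n' where "n' = (if even k then j else i)"
  obtain k' where k': "k = Suc k'" using k(3) by (cases k) auto
  have cancels_k: "cancels ws (alt i j k)" using k(2)[of k'] by (simp add: k')
  have "word_len (ws @ alt i j k) \<le> word_len (ws @ alt i j k @ [n])"
    using cancels_snocI[OF cancels_k, of n] k(1) unfolding n_def alt_Suc_snoc by linarith
  moreover have "word_len (ws @ alt i j k) \<le> word_len (ws @ alt i j k @ [n'])"
  proof -
    have "ws @ alt i j k @ [n'] = (ws @ alt i j k') @ [n', n']"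
      unfolding k' alt_Suc_snoc n'_def by simp
    then have "word_len (ws @ alt i j k @ [n']) = word_len (ws @ alt i j k')"
      by (simp only: word_len_square_cancel)
    moreover have "cancels ws (alt i j k')" by (rule cancels_alt_mono[OF cancels_k]) (simp add: k')
    ultimately show ?thesis using cancels_k k' by (simp add: cancels_def)
  qed
  ultimately show thesis using that[OF _ cancels_k] k(3) by (auto simp: n_def n'_def split: if_splits)
qed

lemma cancelling_alt_lt_braid_order:
  assumes "i \<noteq> j" "cancels ws (alt i j k)" "word_len ws \<le> word_len (ws @ [j])"
  shows "braid_order i j = 0 \<or> k < braid_order i j"
proof (rule ccontr)
  assume "\<not> ?thesis"
  then obtain m where m: "braid_order i j = Suc m" and "Suc m \<le> k" by (cases "braid_order i j") auto
  define v where "v = ws @ alt i j (Suc m)"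
  have len_v: "word_len v + Suc m = word_len ws"
    using cancels_alt_mono[OF assms(2) \<open>Suc m \<le> k\<close>] unfolding cancels_def length_alt v_def .
  have braid: "word_act C (alt i j (Suc m)) = word_act C (alt j i (Suc m))" using word_act_braid[OF assms(1)] m by simp
  have "word_act C (v @ rev (alt i j m)) = word_act C (ws @ [j])"
  proof
    fix f
    have "word_act C (v @ rev (alt i j m)) f = word_act C ws (word_act C (alt j i (Suc m)) (word_act C (rev (alt i j m)) f))"
      unfolding v_def braid[symmetric] by (simp del: alt.simps)
    then show "word_act C (v @ rev (alt i j m)) f = word_act C (ws @ [j]) f" by simp
  qed
  then have "word_len (v @ rev (alt i j m)) = word_len (ws @ [j])" by (rule word_len_cong)
  then show False using word_len_append_le[of v "rev (alt i j m)"] assms(3) len_v by simp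
qed

text \<open>Strip the longest alternating suffix in a right descent \<open>i\<close> and in \<open>j\<close>. What remains has neither as a
  descent, and the suffix is shorter than the braid order, so that it maps the \<open>j\<close>-th simple root to a
  nonnegative combination of the two simple roots.\<close>

theorem ascent_nonneg:
  assumes "word_len ws \<le> word_len (ws @ [j])"
  shows "nonneg (word_act C ws (simple_root j))"
  using assms
proof (induction "word_len ws" arbitrary: ws j rule: less_induct)
  case (less ws j)
  show ?case
  proof (cases "word_len ws = 0")
    case True
    then have "word_act C ws = word_act C []" using ex_reduced_word[of ws] by auto
    then show ?thesis by (simp add: nonneg_def simple_root_def)
  next
    case False
    then obtain i where i: "Suc (word_len (ws @ [i])) = word_len ws" by (rule ex_right_descent)
    with less.prems have "i \<noteq> j" by auto
    obtain k where k: "1 \<le> k" "cancels ws (alt i j k)"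
      and ascents: "\<And>n. n \<in> {i, j} \<Longrightarrow> word_len (ws @ alt i j k) \<le> word_len (ws @ alt i j k @ [n])"
      using maximal_cancelling_alt[OF i, of j] by metis
    define v where "v = ws @ alt i j k"
    have "word_len v < word_len ws" using k by (simp add: cancels_def v_def)
    then have nonneg_v: "nonneg (word_act C v (simple_root i))" "nonneg (word_act C v (simple_root j))"
      using less.hyps[of v] ascents by (simp_all add: v_def)
    have "braid_order i j = 0 \<or> k < braid_order i j"
      using cancelling_alt_lt_braid_order[OF \<open>i \<noteq> j\<close> k(2) less.prems] .
    then obtain p q where "p \<ge> 0" "q \<ge> 0" "alt_root i j k = root_comb i j p q"
      using alt_root_nonneg[OF \<open>i \<noteq> j\<close>] by blast
    moreover have "word_act C ws (simple_root j) = word_act C v (alt_root i j k)"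
      unfolding v_def alt_root_def by simp
    ultimately show ?thesis using nonneg_v by (simp add: word_act_root_comb nonneg_def)
  qed
qed

lemma word_act_snoc_simple_root: "word_act C (ws @ [j]) (simple_root j) = (\<lambda>x. - word_act C ws (simple_root j) x)"
proof -
  have "simple_refl C j (simple_root j) = (\<lambda>x. - simple_root j x)"
    unfolding simple_refl_eq coroot_eval_simple_root by (simp add: fun_eq_iff)
  then show ?thesis by (simp add: word_act_uminus)
qed

lemma descent_nonpos:
  assumes "word_len (ws @ [j]) < word_len ws"
  shows "word_act C ws (simple_root j) k \<le> 0"
proof -
  have "word_len (ws @ [j]) \<le> word_len ((ws @ [j]) @ [j])" using assms by simp
  then have "nonneg (word_act C (ws @ [j]) (simple_root j))" by (rule ascent_nonneg)
  then show ?thesis unfolding word_act_snoc_simple_root nonneg_def by simp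
qed

lemma word_act_simple_root_nonzero: "\<exists>k. word_act C ws (simple_root j) k \<noteq> 0"
proof (rule ccontr)
  assume "\<not> ?thesis"
  then have "word_act C ws (simple_root j) = (\<lambda>k. 0)" by auto
  then have "word_act C (rev ws) (word_act C ws (simple_root j)) j = 0" by (simp add: word_act_zero)
  then show False by (simp add: simple_root_def)
qed

lemma descent_if_nonpos:
  assumes "\<And>k. word_act C ws (simple_root j) k \<le> 0"
  shows "word_len (ws @ [j]) < word_len ws"
proof (rule ccontr)
  assume "\<not> ?thesis"
  then have "nonneg (word_act C ws (simple_root j))" by (intro ascent_nonneg) simp
  then show False using assms word_act_simple_root_nonzero[of ws j] unfolding nonneg_def by (meson order_antisym)
qed

lemma word_len_snoc_cases: "word_len (ws @ [j]) = Suc (word_len ws) \<or> Suc (word_len (ws @ [j])) = word_len ws"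
proof -
  have "word_len (ws @ [j]) \<noteq> word_len ws"
  proof
    assume eq: "word_len (ws @ [j]) = word_len ws"
    then have "nonneg (word_act C (ws @ [j]) (simple_root j))" by (intro ascent_nonneg) simp
    then have "word_len (ws @ [j]) < word_len ws"
      unfolding word_act_snoc_simple_root nonneg_def by (intro descent_if_nonpos) simp
    then show False using eq by simp
  qed
  then show ?thesis using word_len_append_le[of ws "[j]"] word_len_le_append[of ws "[j]"] by auto
qed

lemma word_len_Cons_cases: "word_len (j # ws) = Suc (word_len ws) \<or> Suc (word_len (j # ws)) = word_len ws"
  using word_len_snoc_cases[of "rev ws" j] word_len_rev[of "j # ws"] word_len_rev[of ws] by simp

subsection \<open>Matsumoto's theorem\<close>

lemma two_descents_cancel_alt:
  assumes "i \<noteq> j" "word_len (ws @ [i]) < word_len ws" "word_len (ws @ [j]) < word_len ws"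
    and "braid_order i j = 0 \<or> k \<le> braid_order i j"
  shows "cancels ws (alt i j k)"
  using assms(4)
proof (induction k)
  case (Suc k)
  define n where "n = (if even k then i else j)"
  obtain p q where pq: "p \<ge> 0" "q \<ge> 0" "word_act C (alt i j k) (simple_root n) = root_comb i j p q"
  proof (cases "even k")
    case True
    obtain p q where "p \<ge> 0" "q \<ge> 0" "alt_root j i k = root_comb j i p q"
      by (rule alt_root_nonneg[of j i k]) (use assms(1) Suc.prems braid_order_sym[of i j] in auto)
    then show thesis using True that[of q p] root_comb_commute[of i j] by (simp add: n_def alt_root_def rev_alt)
  next
    case False
    obtain p q where "p \<ge> 0" "q \<ge> 0" "alt_root i j k = root_comb i j p q"
      by (rule alt_root_nonneg[of i j k]) (use assms(1) Suc.prems in auto)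
    then show thesis using False that by (simp add: n_def alt_root_def rev_alt)
  qed
  have "word_act C (ws @ alt i j k) (simple_root n) x \<le> 0" for x
    using descent_nonpos[OF assms(2), of x] descent_nonpos[OF assms(3), of x] pq
    by (simp add: word_act_root_comb add_nonpos_nonpos mult_nonneg_nonpos)
  then have "word_len (ws @ alt i j k @ [n]) < word_len (ws @ alt i j k)"
    using descent_if_nonpos[of "ws @ alt i j k"] by simp
  moreover have "cancels ws (alt i j k)" using Suc by auto
  ultimately show ?case using cancels_snocI unfolding n_def alt_Suc_snoc by blast
qed (simp add: cancels_def)

lemma two_descents_finite_order:
  assumes "i \<noteq> j" "word_len (ws @ [i]) < word_len ws" "word_len (ws @ [j]) < word_len ws"
  shows "braid_order i j \<noteq> 0"
proof
  assume "braid_order i j = 0"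
  then have "cancels ws (alt i j (Suc (word_len ws)))" using two_descents_cancel_alt[OF assms] by blast
  then show False unfolding cancels_def length_alt by linarith
qed

lemma two_descents_factor:
  assumes "i \<noteq> j" "word_len (ws @ [i]) < word_len ws" "word_len (ws @ [j]) < word_len ws"
  defines "m \<equiv> braid_order i j"
  shows "\<exists>zs. \<forall>us\<in>{alt i j m, alt j i m}. word_act C (zs @ rev us) = word_act C ws \<and> reduced (zs @ rev us)"
proof -
  have cancels: "cancels ws (alt i j m)" using two_descents_cancel_alt[OF assms(1-3)] by (simp add: m_def)
  obtain zs where zs: "word_act C zs = word_act C (ws @ alt i j m)" "length zs = word_len (ws @ alt i j m)"
    using ex_reduced_word by blast
  have braid: "word_act C (alt i j m) = word_act C (alt j i m)" using word_act_braid[OF assms(1)] by (simp add: m_def)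
  have "word_act C (zs @ rev us) = word_act C ws \<and> reduced (zs @ rev us)" if us: "us \<in> {alt i j m, alt j i m}" for us
  proof -
    have "word_act C us = word_act C (alt i j m)" using us braid by auto
    then have "word_act C zs = word_act C (ws @ us)" by (intro ext) (simp add: zs(1))
    then have "word_act C (zs @ rev us) = word_act C ((ws @ us) @ rev us)" by (rule word_act_append_cong)
    then have eq: "word_act C (zs @ rev us) = word_act C ws" by (simp add: fun_eq_iff)
    moreover have "length us = m" using us by auto
    ultimately show ?thesis using word_len_cong[OF eq] cancels zs(2) by (simp add: reduced_def cancels_def)
  qed
  then show ?thesis by blast
qed

lemma distinct_last_letters_factor:
  assumes "i \<noteq> j" "reduced (xs @ [i])" "reduced (ys @ [j])" "word_act C (xs @ [i]) = word_act C (ys @ [j])"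
  shows "\<exists>m zs. braid_order i j = Suc m \<and> (\<forall>us\<in>{alt i j (Suc m), alt j i (Suc m)}.
    word_act C (zs @ rev us) = word_act C (xs @ [i]) \<and> reduced (zs @ rev us))"
proof -
  have descent_i: "word_len ((xs @ [i]) @ [i]) < word_len (xs @ [i])"
    using reduced_snoc_descent[OF assms(2)] by simp
  have descent_j: "word_len ((xs @ [i]) @ [j]) < word_len (xs @ [i])"
    using reduced_snoc_descent[OF assms(3)] word_len_cong[OF assms(4)]
      word_len_cong[OF word_act_append_cong[OF assms(4), of "[j]"]] by simp
  obtain m where "braid_order i j = Suc m"
    using two_descents_finite_order[OF assms(1) descent_i descent_j] not0_implies_Suc by blast
  then show ?thesis using two_descents_factor[OF assms(1) descent_i descent_j] by auto
qed

theorem matsumoto: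
  fixes X :: "'j \<Rightarrow> 'x \<Rightarrow> 'x"
  assumes braid: "\<And>i j. i \<noteq> j \<Longrightarrow> foldr X (alt i j (braid_order i j)) = foldr X (alt j i (braid_order i j))"
    and "reduced ws" "reduced ws'" "word_act C ws = word_act C ws'"
  shows "foldr X ws = foldr X ws'"
  using assms(2-4)
proof (induction "length ws" arbitrary: ws ws' rule: less_induct)
  case less
  have same_last: "foldr X us = foldr X us'"
    if eq: "word_act C us = word_act C ws" "word_act C us' = word_act C ws"
      and red: "reduced us" "reduced us'" and us: "us = xs @ [k]" "us' = ys @ [k]" for us us' xs ys k
  proof -
    have "length us = length ws" using reduced_length_eq[OF eq(1) red(1) less.prems(1)] .
    moreover have "word_act C xs = word_act C ys"
      using word_act_append_eq_iff[of xs "[k]" ys] eq unfolding us by metis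
    ultimately have "foldr X xs = foldr X ys"
      using red reduced_appendD unfolding us by (intro less.hyps) auto
    then show ?thesis by (simp add: us fun_eq_iff)
  qed
  have len: "length ws' = length ws" using reduced_length_eq[OF less.prems(3,1,2)] by simp
  show ?case
  proof (cases ws rule: rev_cases)
    case Nil
    then show ?thesis using len by simp
  next
    case ws: (snoc xs i)
    obtain ys j where ws': "ws' = ys @ [j]" using len ws by (cases ws' rule: rev_cases) auto
    show ?thesis
    proof (cases "i = j")
      case True
      then show ?thesis using same_last[OF refl _ less.prems(1,2) ws] less.prems(3) ws' by simp
    next
      case False
      then obtain m zs where m: "braid_order i j = Suc m"
        and zs: "\<forall>us\<in>{alt i j (Suc m), alt j i (Suc m)}. word_act C (zs @ rev us) = word_act C ws \<and> reduced (zs @ rev us)"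
        using distinct_last_letters_factor less.prems unfolding ws ws' by metis
      have "foldr X ws = foldr X (zs @ rev (alt i j (Suc m)))"
        using zs less.prems(1) by (intro same_last[OF _ _ _ _ ws, of _ "zs @ rev (alt j i m)"]) auto
      also have "\<dots> = foldr X (zs @ rev (alt j i (Suc m)))"
        using braid[OF False] by (simp add: rev_alt m fun_eq_iff del: alt.simps)
      also have "\<dots> = foldr X ws'"
        using zs less.prems by (intro same_last[OF _ _ _ _ _ ws', of _ "zs @ rev (alt i j m)"]) auto
      finally show ?thesis .
    qed
  qed
qed

end

section \<open>Weights, coweights and words in the affine generators\<close>

lemma lookup_lsc [simp]: "Poly_Mapping.lookup (lsc c v) k = c * Poly_Mapping.lookup v k"
  unfolding lsc_def lookup_sum lookup_single by (simp add: when_def)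

lemma lookup_alpha [simp]: "Poly_Mapping.lookup (alpha A j) i = A i j"
  unfolding alpha_def lookup_sum lookup_single by (simp add: when_def)

lemma lookup_unitv [simp]: "Poly_Mapping.lookup (unitv i) k = (if k = i then 1 else 0)"
  unfolding unitv_def lookup_single by (simp add: when_def)

lemma lpair_zero_left [simp]: "lpair 0 z = 0"
  by (simp add: lpair_def)

lemma lpair_minus_left: "lpair (x - y) z = lpair x z - lpair y z"
  by (simp add: lpair_def lookup_minus sum_subtractf left_diff_distrib)

lemma lpair_minus_right: "lpair z (x - y) = lpair z x - lpair z y"
  by (simp add: lpair_def lookup_minus sum_subtractf right_diff_distrib)

lemma lpair_plus_left: "lpair (x + y) z = lpair x z + lpair y z"
  by (simp add: lpair_def lookup_add sum.distrib distrib_right)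

lemma lpair_plus_right: "lpair z (x + y) = lpair z x + lpair z y"
  by (simp add: lpair_def lookup_add sum.distrib distrib_left)

lemma lpair_uminus_left: "lpair (- x) z = - lpair x z"
  by (simp add: lpair_def sum_negf)

lemma lpair_uminus_right: "lpair z (- x) = - lpair z x"
  by (simp add: lpair_def sum_negf)

lemma lpair_lsc_left: "lpair (lsc c x) z = c * lpair x z"
  by (simp add: lpair_def sum_distrib_left mult.assoc)

lemma lpair_lsc_right: "lpair z (lsc c x) = c * lpair z x"
  by (simp add: lpair_def sum_distrib_left mult.left_commute)

lemma lpair_sum_right: "lpair m (\<Sum>k\<in>S. g k) = (\<Sum>k\<in>S. lpair m (g k))"
  unfolding lpair_def lookup_sum sum_distrib_left by (rule sum.swap)

lemma lpair_unitv_left [simp]: "lpair (unitv i) z = Poly_Mapping.lookup z i"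
  by (simp add: lpair_def if_distrib[of "\<lambda>x. x * _"] cong: if_cong)

lemmas lpair_simps = lpair_plus_left lpair_plus_right lpair_minus_left lpair_minus_right
  lpair_uminus_left lpair_uminus_right lpair_lsc_left lpair_lsc_right

definition lattice_linear :: "('n::{finite,linorder} lat \<Rightarrow> 'n lat) \<Rightarrow> bool" where
  "lattice_linear f \<longleftrightarrow> (\<forall>p c q. f (p + lsc c q) = f p + lsc c (f q))"

lemma lattice_linear_id: "lattice_linear id"
  by (simp add: lattice_linear_def)

lemma lattice_linear_comp: "lattice_linear f \<Longrightarrow> lattice_linear g \<Longrightarrow> lattice_linear (f \<circ> g)"
  by (simp add: lattice_linear_def)

lemma lattice_linear_add:
  assumes "lattice_linear f"
  shows "f (p + q) = f p + f q"
proof -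
  have "lsc 1 x = x" for x :: "'a lat" by (rule poly_mapping_eqI) simp
  then show ?thesis using assms unfolding lattice_linear_def by metis
qed

lemma lattice_linear_0: "lattice_linear f \<Longrightarrow> f 0 = 0"
  using lattice_linear_add[of f 0 0] by simp

lemma lattice_linear_lsc: "lattice_linear f \<Longrightarrow> f (lsc c q) = lsc c (f q)"
  using lattice_linear_0[of f] unfolding lattice_linear_def by (metis add_0)

lemma lattice_linear_uminus: "lattice_linear f \<Longrightarrow> f (- q) = - f q"
  using lattice_linear_add[of f q "- q"] lattice_linear_0[of f] by (simp add: minus_unique)

lemma lattice_linear_diff: "lattice_linear f \<Longrightarrow> f (p - q) = f p - f q"
  using lattice_linear_add[of f p "- q"] lattice_linear_uminus[of f q] by simp

lemma fst_amult [simp]: "fst (amult x y) = fst x \<circ> fst y"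
  by (simp add: amult_def split: prod.split)

lemma fst_snd_amult [simp]: "fst (snd (amult x y)) = fst (snd x) \<circ> fst (snd y)"
  by (simp add: amult_def split: prod.split)

lemma snd_snd_amult [simp]: "snd (snd (amult x y)) = snd (snd x) + fst (snd x) (snd (snd y))"
  by (simp add: amult_def split: prod.split)

lemma aone_sel [simp]: "fst aone = id" "fst (snd aone) = id" "snd (snd aone) = 0"
  by (simp_all add: aone_def)

lemma amult_assoc: "lattice_linear (fst (snd x)) \<Longrightarrow> amult (amult x y) z = amult x (amult y z)"
  by (intro prod_eqI) (simp_all add: o_assoc lattice_linear_add add.assoc)

lemma amult_aone [simp]: "amult aone x = x" "lattice_linear (fst (snd x)) \<Longrightarrow> amult x aone = x"
  by (auto intro!: prod_eqI simp: lattice_linear_0)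

definition acoroot :: "('n::{finite,linorder} \<Rightarrow> 'n \<Rightarrow> int) \<Rightarrow> 'n option \<Rightarrow> 'n lat" where
  "acoroot A j = (case j of None \<Rightarrow> - coroot A (highest_root A) | Some i \<Rightarrow> unitv i)"

lemma fst_agen: "fst (agen A j) l = l - lsc (lpair (acoroot A j) l) (aalpha A j)"
  by (rule poly_mapping_eqI)
     (auto simp: agen_def sgen_def szero_def acoroot_def aalpha_def Let_def lookup_minus lpair_simps split: option.split)

lemma fst_snd_agen: "fst (snd (agen A j)) m = m - lsc (lpair m (aalpha A j)) (acoroot A j)"
  by (rule poly_mapping_eqI)
     (auto simp: agen_def sgen_def szero_def acoroot_def aalpha_def Let_def lookup_minus lpair_simps split: option.split)

lemma snd_snd_agen: "snd (snd (agen A j)) = (if j = None then - acoroot A None else 0)"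
  by (auto simp: agen_def sgen_def szero_def acoroot_def Let_def split: option.split)

lemma lattice_linear_agen: "lattice_linear (fst (agen A j))" "lattice_linear (fst (snd (agen A j)))"
  unfolding lattice_linear_def fst_agen fst_snd_agen
  by (auto intro!: poly_mapping_eqI simp: lpair_simps lookup_add lookup_minus algebra_simps)

lemma wordprod_Nil [simp]: "wordprod A [] = aone"
  by (simp add: wordprod_def)

lemma wordprod_Cons [simp]: "wordprod A (j # ws) = amult (agen A j) (wordprod A ws)"
  by (simp add: wordprod_def)

lemma lattice_linear_wordprod: "lattice_linear (fst (wordprod A ws))" "lattice_linear (fst (snd (wordprod A ws)))"
  by (induction ws) (simp_all add: lattice_linear_id lattice_linear_comp lattice_linear_agen)

lemma wordprod_append: "wordprod A (us @ vs) = amult (wordprod A us) (wordprod A vs)"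
  by (induction us) (simp_all add: amult_assoc lattice_linear_agen)

lemma wordprod_single: "wordprod A [j] = agen A j"
  by (simp add: lattice_linear_agen)

lemma wordprod_snoc: "wordprod A (ws @ [j]) = amult (wordprod A ws) (agen A j)"
  unfolding wordprod_append wordprod_single ..

lemma wordprod_pairing:
  assumes "\<And>j. j \<in> set ws \<Longrightarrow> lpair (acoroot A j) (aalpha A j) = 2"
  shows "lpair (fst (snd (wordprod A ws)) m) (fst (wordprod A ws) l) = lpair m l"
  using assms
proof (induction ws)
  case (Cons j ws)
  have "lpair (acoroot A j) (aalpha A j) = 2" by (rule Cons.prems) simp
  then show ?case using Cons by (simp add: fst_agen fst_snd_agen lpair_simps algebra_simps)
qed simp

lemma affW_iff: "x \<in> affW A \<longleftrightarrow> (\<exists>ws. x = wordprod A ws)"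
proof
  show "x \<in> affW A \<Longrightarrow> \<exists>ws. x = wordprod A ws"
  proof (induction rule: affW.induct)
    case one
    show ?case by (rule exI[of _ "[]"]) simp
  next
    case (step w j)
    then show ?case by (metis wordprod_snoc)
  qed
  have "wordprod A ws \<in> affW A" for ws
    by (induction ws rule: rev_induct) (simp_all only: wordprod_Nil wordprod_snoc affW.intros)
  then show "\<exists>ws. x = wordprod A ws \<Longrightarrow> x \<in> affW A" by blast
qed

lemma weylW_iff: "x \<in> weylW A \<longleftrightarrow> (\<exists>ws. x = wordprod A (map Some ws))"
proof
  have sgen: "sgen A i = agen A (Some i)" for i by (simp add: agen_def)
  show "x \<in> weylW A \<Longrightarrow> \<exists>ws. x = wordprod A (map Some ws)"
  proof (induction rule: weylW.induct)
    case one
    show ?case by (rule exI[of _ "[]"]) simp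
  next
    case (step w i)
    then obtain ws where "w = wordprod A (map Some ws)" by blast
    then have "amult w (sgen A i) = wordprod A (map Some (ws @ [i]))" by (simp add: sgen wordprod_snoc)
    then show ?case by blast
  qed
  have "wordprod A (map Some ws) \<in> weylW A" for ws
  proof (induction ws rule: rev_induct)
    case (snoc i ws)
    then show ?case using weylW.step[of "wordprod A (map Some ws)" A i] by (simp add: wordprod_snoc sgen)
  qed (simp add: weylW.one)
  then show "\<exists>ws. x = wordprod A (map Some ws) \<Longrightarrow> x \<in> weylW A" by blast
qed

lemma weylW_subset_affW: "weylW A \<subseteq> affW A"
  using weylW_iff affW_iff by blast

lemma weylW_amult: "x \<in> weylW A \<Longrightarrow> y \<in> weylW A \<Longrightarrow> amult x y \<in> weylW A"
  unfolding weylW_iff by (metis map_append wordprod_append)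

lemma affW_amult: "x \<in> affW A \<Longrightarrow> y \<in> affW A \<Longrightarrow> amult x y \<in> affW A"
  unfolding affW_iff by (metis wordprod_append)

lemma affW_wordprod [simp]: "wordprod A ws \<in> affW A"
  using affW_iff by blast

lemma affW_aone [simp]: "aone \<in> affW A"
  by (rule affW.one)

lemma affW_agen [simp]: "agen A j \<in> affW A"
  using affW_wordprod[of A "[j]"] by (simp only: wordprod_single)

lemma affW_lattice_linear: "x \<in> affW A \<Longrightarrow> lattice_linear (fst x)" "x \<in> affW A \<Longrightarrow> lattice_linear (fst (snd x))"
  using affW_iff lattice_linear_wordprod by metis+

section \<open>Finite root systems\<close>

locale finite_cartan =
  fixes A :: "'n::{finite,linorder} \<Rightarrow> 'n \<Rightarrow> int"
  assumes cartan_finite: "cartan_finite A"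
begin

sublocale fin: generalized_cartan A
  by standard (use cartan_finite in \<open>simp_all add: cartan_finite_def\<close>)

definition is_symmetrizer :: "('n \<Rightarrow> real) \<Rightarrow> bool" where
  "is_symmetrizer d \<longleftrightarrow> (\<forall>i. d i > 0) \<and> (\<forall>i j. d i * A i j = d j * A j i)
     \<and> (\<forall>x::'n \<Rightarrow> real. (\<exists>i. x i \<noteq> 0) \<longrightarrow> (\<Sum>i\<in>UNIV. \<Sum>j\<in>UNIV. x i * d i * A i j * x j) > 0)"

definition symmetrizer :: "'n \<Rightarrow> real" where
  "symmetrizer = (SOME d. is_symmetrizer d)"

lemma symmetrizer_pos: "symmetrizer i > 0"
  and symmetrizer_sym: "symmetrizer i * A i j = symmetrizer j * A j i"
  and symmetrizer_posdef: "x i \<noteq> 0 \<Longrightarrow> (\<Sum>i\<in>UNIV. \<Sum>j\<in>UNIV. x i * symmetrizer i * A i j * x j) > 0"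
proof -
  have "\<exists>d. is_symmetrizer d"
    using cartan_finite unfolding cartan_finite_def is_symmetrizer_def by (elim conjE)
  then have "is_symmetrizer symmetrizer" unfolding symmetrizer_def by (rule someI_ex)
  then show "symmetrizer i > 0" "symmetrizer i * A i j = symmetrizer j * A j i"
    "x i \<noteq> 0 \<Longrightarrow> (\<Sum>i\<in>UNIV. \<Sum>j\<in>UNIV. x i * symmetrizer i * A i j * x j) > 0"
    unfolding is_symmetrizer_def by blast+
qed

subsection \<open>The invariant form\<close>

definition form :: "('n \<Rightarrow> int) \<Rightarrow> ('n \<Rightarrow> int) \<Rightarrow> real" where
  "form f g = (\<Sum>i\<in>UNIV. real_of_int (f i) * symmetrizer i * real_of_int (coroot_eval A i g))"

lemma form_eq: "form f g = (\<Sum>i\<in>UNIV. \<Sum>j\<in>UNIV. real_of_int (f i) * symmetrizer i * A i j * real_of_int (g j))"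
  unfolding form_def coroot_eval_def of_int_sum sum_distrib_left
  by (intro sum.cong refl) (simp add: algebra_simps)

lemma form_sym: "form f g = form g f"
proof -
  have "form f g = (\<Sum>j\<in>UNIV. \<Sum>i\<in>UNIV. real_of_int (f i) * symmetrizer i * A i j * real_of_int (g j))"
    unfolding form_eq by (rule sum.swap)
  also have "\<dots> = (\<Sum>j\<in>UNIV. \<Sum>i\<in>UNIV. real_of_int (g j) * symmetrizer j * A j i * real_of_int (f i))"
    by (intro sum.cong refl) (use symmetrizer_sym in \<open>simp add: algebra_simps\<close>)
  finally show ?thesis unfolding form_eq .
qed

lemma form_linear_left: "form (\<lambda>x. p * f x + q * g x) h = p * form f h + q * form g h"
  unfolding form_def sum_distrib_left sum.distrib[symmetric] by (intro sum.cong refl) (simp add: algebra_simps)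

lemma form_diff_left: "form (\<lambda>x. f x - q * g x) h = form f h - q * form g h"
  using form_linear_left[of 1 f "-q" g h] by simp

lemma form_diff_right: "form h (\<lambda>x. f x - q * g x) = form h f - q * form h g"
  using form_diff_left[of f q g h] by (simp add: form_sym)

lemma form_simple_root: "form (simple_root i) g = symmetrizer i * coroot_eval A i g"
  by (simp add: form_def simple_root_def if_distrib[of "\<lambda>x. x * _"] if_distrib[of of_int] cong: if_cong)

lemma form_simple_root_right: "form g (simple_root i) = symmetrizer i * coroot_eval A i g"
  using form_simple_root form_sym by simp

lemma form_pos: "f i \<noteq> 0 \<Longrightarrow> form f f > 0"
  using symmetrizer_posdef[of "\<lambda>i. real_of_int (f i)" i] by (simp add: form_eq)

lemma form_nonneg: "form f f \<ge> 0"
proof (cases "\<exists>i. f i \<noteq> 0")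
  case True
  then show ?thesis using form_pos less_imp_le by blast
qed (simp add: form_def)

lemma form_simple_refl: "form (simple_refl A i f) (simple_refl A i g) = form f g"
  unfolding simple_refl_eq form_diff_left form_diff_right
  by (simp add: form_simple_root form_simple_root_right algebra_simps)

lemma form_word_act: "form (word_act A ws f) (word_act A ws g) = form f g"
  by (induction ws) (simp_all add: form_simple_refl)

lemma form_word_act_left: "form (word_act A ws f) g = form f (word_act A (rev ws) g)"
  using form_word_act[of ws f "word_act A (rev ws) g"] by simp

lemma coroot_eval_eqI:
  assumes "\<And>i. coroot_eval A i f = coroot_eval A i g"
  shows "f = g"
proof (rule ext, rule ccontr)
  fix k assume "f k \<noteq> g k"
  then have "form (\<lambda>x. f x - g x) (\<lambda>x. f x - g x) > 0" by (intro form_pos[of _ k]) simp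
  then show False using assms by (simp add: form_def coroot_eval_diff)
qed

lemma coweight_eq_0I:
  assumes "\<And>j. lpair m (alpha A j) = 0"
  shows "m = 0"
proof (rule poly_mapping_eqI, rule ccontr)
  fix k assume k: "Poly_Mapping.lookup m k \<noteq> Poly_Mapping.lookup 0 k"
  define x where "x = (\<lambda>i. real_of_int (Poly_Mapping.lookup m i) / symmetrizer i)"
  have x: "x i * symmetrizer i = real_of_int (Poly_Mapping.lookup m i)" for i
    using symmetrizer_pos[of i] by (simp add: x_def)
  have "x k \<noteq> 0" using k symmetrizer_pos[of k] by (simp add: x_def)
  then have "0 < (\<Sum>i\<in>UNIV. \<Sum>j\<in>UNIV. x i * symmetrizer i * A i j * x j)" by (rule symmetrizer_posdef)
  also have "\<dots> = (\<Sum>j\<in>UNIV. \<Sum>i\<in>UNIV. x i * symmetrizer i * A i j * x j)" by (rule sum.swap)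
  also have "\<dots> = (\<Sum>j\<in>UNIV. real_of_int (lpair m (alpha A j)) * x j)"
    unfolding x by (simp add: lpair_def sum_distrib_right)
  finally show False by (simp add: assms)
qed

lemma integrality_bound:
  assumes "2 * form f g = of_int n * form g g" "2 * form f g = of_int n' * form f f" "f k \<noteq> 0"
  shows "n * n' \<le> 4" and "n * n' = 4 \<Longrightarrow> 2 * f x = n * g x"
proof -
  define h where "h = (\<lambda>x. 2 * f x + (- n) * g x)"
  have "form h h = 4 * form f f - 4 * n * form f g + n * (n * form g g)"
    unfolding h_def form_linear_left form_sym[of _ "\<lambda>x. 2 * f x + (- n) * g x"]
    using form_sym[of g f] by (simp add: algebra_simps)
  also have "\<dots> = 4 * form f f - n * (2 * form f g)" using assms(1) by (simp add: algebra_simps)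
  also have "\<dots> = form f f * of_int (4 - n * n')" unfolding assms(2) by (simp add: algebra_simps)
  finally have h: "form h h = form f f * of_int (4 - n * n')" .
  have "form f f > 0" using assms(3) by (rule form_pos)
  then have "real_of_int (4 - n * n') \<ge> 0" using h form_nonneg[of h] by (simp add: zero_le_mult_iff)
  then show "n * n' \<le> 4" by linarith
  assume "n * n' = 4"
  then have "form h h = 0" using h by simp
  then have "h x = 0" using form_pos[of h x] by force
  then show "2 * f x = n * g x" by (simp add: h_def)
qed

subsection \<open>Roots\<close>

definition root_vecs :: "('n \<Rightarrow> int) set" where
  "root_vecs = {word_act A ws (simple_root i) | ws i. True}"

lemma root_vecs_cases:
  assumes "f \<in> root_vecs"
  obtains ws i where "f = word_act A ws (simple_root i)"
  using assms unfolding root_vecs_def by blast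

lemma root_vecsI: "word_act A ws (simple_root i) \<in> root_vecs"
  unfolding root_vecs_def by blast

lemma simple_root_in_root_vecs: "simple_root i \<in> root_vecs"
  using root_vecsI[of "[]"] by simp

lemma word_act_root_vecs: "f \<in> root_vecs \<Longrightarrow> word_act A ws f \<in> root_vecs"
  using root_vecsI[of "ws @ _"] by (auto elim!: root_vecs_cases)

lemma simple_refl_root_vecs: "f \<in> root_vecs \<Longrightarrow> simple_refl A i f \<in> root_vecs"
  using word_act_root_vecs[of f "[i]"] by simp

lemma uminus_root_vecs: "f \<in> root_vecs \<Longrightarrow> (\<lambda>x. - f x) \<in> root_vecs"
  using root_vecsI fin.word_act_snoc_simple_root by (metis root_vecs_cases)

lemma root_vecs_sign:
  assumes "f \<in> root_vecs"
  shows "(\<forall>k. f k \<ge> 0) \<or> (\<forall>k. f k \<le> 0)"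
proof -
  obtain ws i where f: "f = word_act A ws (simple_root i)" using assms by (rule root_vecs_cases)
  show ?thesis
  proof (cases "fin.word_len ws \<le> fin.word_len (ws @ [i])")
    case True
    then show ?thesis using fin.ascent_nonneg f by (simp add: nonneg_def)
  next
    case False
    then show ?thesis using fin.descent_nonpos[of ws i] f by simp
  qed
qed

lemma root_vecs_nonzero:
  assumes "f \<in> root_vecs"
  obtains k where "f k \<noteq> 0"
  using assms fin.word_act_simple_root_nonzero by (metis root_vecs_cases)

lemma root_vecs_form_pos: "f \<in> root_vecs \<Longrightarrow> form f f > 0"
  using root_vecs_nonzero form_pos by metis

lemma form_root_eq:
  assumes "b = word_act A ws (simple_root k)"
  shows "2 * form b f = of_int (coroot_eval A k (word_act A (rev ws) f)) * form b b"
proof -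
  have "form b b = 2 * symmetrizer k" unfolding assms form_word_act form_simple_root by simp
  moreover have "form b f = symmetrizer k * coroot_eval A k (word_act A (rev ws) f)"
    unfolding assms form_word_act_left form_simple_root ..
  ultimately show ?thesis by simp
qed

lemma reflect_root_vecs:
  assumes "b = word_act A ws (simple_root k)" "f \<in> root_vecs"
  shows "(\<lambda>x. f x - coroot_eval A k (word_act A (rev ws) f) * b x) \<in> root_vecs"
proof -
  have "(\<lambda>x. f x - coroot_eval A k (word_act A (rev ws) f) * b x) = word_act A (ws @ [k] @ rev ws) f"
    by (simp only: foldr_append foldr.simps comp_apply id_apply simple_refl_eq word_act_diff assms(1) fin.word_act_rev_cancel)
  then show ?thesis using word_act_root_vecs[OF assms(2)] by metis
qed

lemma coroot_eval_root_vecs_bound: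
  assumes "f \<in> root_vecs"
  shows "coroot_eval A k f \<in> {-4..4}"
proof (cases "coroot_eval A k f = 0")
  case False
  define n where "n = coroot_eval A k f"
  obtain ws i where f: "f = word_act A ws (simple_root i)" using assms by (rule root_vecs_cases)
  define n' where "n' = coroot_eval A i (word_act A (rev ws) (simple_root k))"
  have n: "2 * form f (simple_root k) = of_int n * form (simple_root k) (simple_root k)"
    by (simp add: form_simple_root_right n_def)
  have n': "2 * form f (simple_root k) = of_int n' * form f f" unfolding n'_def by (rule form_root_eq[OF f])
  obtain k0 where "f k0 \<noteq> 0" using assms by (rule root_vecs_nonzero)
  then have "n * n' \<le> 4" using integrality_bound(1)[OF n n'] by blast
  have pos: "form (simple_root k) (simple_root k) > 0" "form f f > 0"
    using root_vecs_form_pos assms simple_root_in_root_vecs by auto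
  have "of_int (n * n') * (form (simple_root k) (simple_root k) * form f f) = (2 * form f (simple_root k))\<^sup>2"
    unfolding power2_eq_square by (subst (1) n, subst n') simp
  moreover have "form f (simple_root k) \<noteq> 0" using n pos(1) False by (auto simp: n_def)
  ultimately have "0 < real_of_int (n * n') * (form (simple_root k) (simple_root k) * form f f)" by simp
  then have "0 < real_of_int (n * n')" by (rule zero_less_mult_pos2) (use pos in simp)
  then have "0 < n * n'" by (simp only: of_int_0_less_iff)
  then have "n' \<noteq> 0" and abs_prod: "n * n' = \<bar>n\<bar> * \<bar>n'\<bar>" by (auto simp flip: abs_mult)
  then have "\<bar>n\<bar> * 1 \<le> \<bar>n\<bar> * \<bar>n'\<bar>" by (intro mult_left_mono) auto
  then have "\<bar>n\<bar> \<le> 4" using \<open>n * n' \<le> 4\<close> abs_prod by simp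
  then show ?thesis by (simp add: n_def abs_le_iff)
qed simp

lemma finite_root_vecs: "finite root_vecs"
proof -
  have "(\<lambda>f i. coroot_eval A i f) ` root_vecs \<subseteq> {g. \<forall>i. g i \<in> {-4..4}}"
    using coroot_eval_root_vecs_bound by blast
  moreover have "finite {g :: 'n \<Rightarrow> int. \<forall>i. g i \<in> {-4..4}}"
    using finite_set_of_finite_funs[of "UNIV :: 'n set" "{-4..4 :: int}" 0] by simp
  ultimately have "finite ((\<lambda>f i. coroot_eval A i f) ` root_vecs)" by (rule finite_subset)
  moreover have "inj_on (\<lambda>f i. coroot_eval A i f) root_vecs"
    by (intro inj_onI coroot_eval_eqI) (simp add: fun_eq_iff)
  ultimately show ?thesis by (rule finite_imageD)
qed

lemma root_vecs_diff:
  assumes "f \<in> root_vecs" "g \<in> root_vecs" "f \<noteq> g" "form f g > 0"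
  shows "(\<lambda>x. f x - g x) \<in> root_vecs"
proof -
  obtain ws i where f: "f = word_act A ws (simple_root i)" using assms(1) by (rule root_vecs_cases)
  obtain vs j where g: "g = word_act A vs (simple_root j)" using assms(2) by (rule root_vecs_cases)
  define n where "n = coroot_eval A j (word_act A (rev vs) f)"
  define n' where "n' = coroot_eval A i (word_act A (rev ws) g)"
  have n: "2 * form f g = of_int n * form g g" "2 * form f g = of_int n' * form f f"
    using form_root_eq[OF g, of f] form_root_eq[OF f, of g] by (simp_all add: n_def n'_def form_sym)
  have "form f f > 0" "form g g > 0" using root_vecs_form_pos assms(1,2) by auto
  then have pos: "n > 0" "n' > 0" using n assms(4) by (smt (verit) mult_nonpos_nonneg of_int_le_0_iff)+
  obtain k where "f k \<noteq> 0" using assms(1) by (rule root_vecs_nonzero)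
  note bound = integrality_bound[OF n this]
  consider (reflect_f) "n = 1" | (reflect_g) "n' = 1" | (proportional) "n \<ge> 2" "n' \<ge> 2" using pos by linarith
  then show ?thesis
  proof cases
    case reflect_f
    then show ?thesis using reflect_root_vecs[OF g assms(1)] by (simp add: n_def)
  next
    case reflect_g
    then have "(\<lambda>x. g x - f x) \<in> root_vecs" using reflect_root_vecs[OF f assms(2)] by (simp add: n'_def)
    then show ?thesis using uminus_root_vecs by fastforce
  next
    case proportional
    then have "2 * 2 \<le> n * n'" "n * 2 \<le> n * n'" by (intro mult_mono; simp)+
    then have "n = 2" "n * n' = 4" using bound(1) \<open>n \<ge> 2\<close> by linarith+
    then have "f = g" using bound(2) by (intro ext) simp
    then show ?thesis using assms(3) by simp
  qed
qed

subsection \<open>Root vectors as weights\<close>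

definition root_weight :: "('n \<Rightarrow> int) \<Rightarrow> 'n lat" where
  "root_weight f = (\<Sum>k\<in>UNIV. lsc (f k) (alpha A k))"

lemma lookup_root_weight [simp]: "Poly_Mapping.lookup (root_weight f) i = coroot_eval A i f"
  unfolding root_weight_def lookup_sum coroot_eval_def by (simp add: mult.commute)

lemma root_weight_simple_root: "root_weight (simple_root i) = alpha A i"
  by (rule poly_mapping_eqI) simp

lemma root_weight_diff: "root_weight (\<lambda>x. f x - g x) = root_weight f - root_weight g"
  by (rule poly_mapping_eqI) (simp add: lookup_minus coroot_eval_diff)

lemma root_weight_inject: "root_weight f = root_weight g \<longleftrightarrow> f = g"
  using coroot_eval_eqI[of f g] lookup_root_weight by metis

abbreviation fin_word :: "'n list \<Rightarrow> 'n aff" where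
  "fin_word ws \<equiv> wordprod A (map Some ws)"

lemma fin_word_root_weight: "fst (fin_word ws) (root_weight f) = root_weight (word_act A ws f)"
proof (induction ws)
  case (Cons i ws)
  have "fst (agen A (Some i)) (root_weight g) = root_weight (simple_refl A i g)" for g
    by (rule poly_mapping_eqI)
      (simp add: agen_def sgen_def lookup_minus simple_refl_def coroot_eval_upd)
  then show ?case using Cons by simp
qed simp

lemma fin_word_pairing: "lpair (fst (snd (fin_word ws)) m) (fst (fin_word ws) l) = lpair m l"
  by (rule wordprod_pairing) (auto simp: acoroot_def aalpha_def)

lemma lpair_word_coroot:
  "lpair (fst (snd (fin_word ws)) (unitv i)) (root_weight f) = coroot_eval A i (word_act A (rev ws) f)"
proof -
  have "root_weight f = fst (fin_word ws) (root_weight (word_act A (rev ws) f))" by (simp add: fin_word_root_weight)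
  then show ?thesis by (simp only: fin_word_pairing lpair_unitv_left lookup_root_weight)
qed

lemma roots_eq: "roots A = root_weight ` root_vecs"
proof -
  have simple: "fst (fin_word ws) (alpha A i) = root_weight (word_act A ws (simple_root i))" for ws i
    using fin_word_root_weight[of ws "simple_root i"] by (simp add: root_weight_simple_root)
  have "roots A = {fst (fin_word ws) (alpha A i) | ws i. True}"
    unfolding roots_def weylW_iff by blast
  then show ?thesis unfolding simple root_vecs_def by blast
qed

lemma root_weight_dominance:
  "(\<exists>c. root_weight f - root_weight g = (\<Sum>i\<in>UNIV. lsc (int (c i)) (alpha A i))) \<longleftrightarrow> (\<forall>k. g k \<le> f k)"
proof
  assume "\<exists>c. root_weight f - root_weight g = (\<Sum>i\<in>UNIV. lsc (int (c i)) (alpha A i))"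
  then obtain c where "root_weight (\<lambda>x. f x - g x) = root_weight (\<lambda>x. int (c x))"
    unfolding root_weight_diff by (auto simp: root_weight_def)
  then have "f k - g k = int (c k)" for k unfolding root_weight_inject by (rule fun_cong)
  then show "\<forall>k. g k \<le> f k" by (metis diff_ge_0_iff_ge of_nat_0_le_iff)
next
  assume "\<forall>k. g k \<le> f k"
  then have "root_weight (\<lambda>x. f x - g x) = (\<Sum>i\<in>UNIV. lsc (int (nat (f i - g i))) (alpha A i))"
    by (simp add: root_weight_def)
  then show "\<exists>c. root_weight f - root_weight g = (\<Sum>i\<in>UNIV. lsc (int (c i)) (alpha A i))"
    unfolding root_weight_diff by (intro exI[of _ "\<lambda>i. nat (f i - g i)"])
qed

subsection \<open>Dominant roots\<close>

definition height :: "('n \<Rightarrow> int) \<Rightarrow> int" where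
  "height f = (\<Sum>k\<in>UNIV. f k)"

definition dominant :: "('n \<Rightarrow> int) \<Rightarrow> bool" where
  "dominant f \<longleftrightarrow> (\<forall>i. coroot_eval A i f \<ge> 0)"

lemma height_simple_refl: "height (simple_refl A i f) = height f - coroot_eval A i f"
  using sum_fun_upd[of "\<lambda>_. 1" f i "f i - coroot_eval A i f"] by (simp add: height_def simple_refl_def)

lemma height_strict_mono:
  assumes "\<And>k. f k \<le> g k" "f \<noteq> g"
  shows "height f < height g"
proof -
  obtain k where "f k \<noteq> g k" using assms(2) by blast
  then have "f k < g k" using assms(1)[of k] by simp
  then show ?thesis unfolding height_def using assms(1) by (intro sum_strict_mono_ex1) auto
qed

lemma dominant_root_pos_coroot:
  assumes "f \<in> root_vecs" "dominant f"
  obtains i where "coroot_eval A i f > 0"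
proof -
  have "\<not> (\<forall>i. coroot_eval A i f = 0)"
  proof
    assume "\<forall>i. coroot_eval A i f = 0"
    then show False using root_vecs_form_pos[OF assms(1)] by (simp add: form_def)
  qed
  then obtain i where "coroot_eval A i f \<noteq> 0" by blast
  then show thesis using assms(2) that[of i] by (simp add: dominant_def less_le)
qed

lemma dominant_root_nonneg:
  assumes "f \<in> root_vecs" "dominant f"
  shows "f k \<ge> 0"
proof -
  have "\<not> (\<forall>k. f k \<le> 0)"
  proof
    assume "\<forall>k. f k \<le> 0"
    then have "form f f \<le> 0" unfolding form_def using symmetrizer_pos assms(2)
      by (intro sum_nonpos mult_nonpos_nonneg) (auto simp: dominant_def mult_nonpos_nonneg less_imp_le)
    then show False using root_vecs_form_pos[OF assms(1)] by simp
  qed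
  then show ?thesis using root_vecs_sign[OF assms(1)] by blast
qed

text \<open>A root of maximal height above \<open>b\<close> is dominant, since reflecting it in a simple root with negative
  pairing would increase it.\<close>

lemma ex_dominant_root_above:
  assumes "b \<in> root_vecs"
  obtains c where "c \<in> root_vecs" "dominant c" "\<And>k. b k \<le> c k"
proof -
  define above where "above = {c \<in> root_vecs. \<forall>k. b k \<le> c k}"
  have "finite above" "above \<noteq> {}" using finite_root_vecs assms by (auto simp: above_def)
  then obtain c where c: "c \<in> above" and "Max (height ` above) = height c" by (rule obtains_MAX)
  then have max: "height c' \<le> height c" if "c' \<in> above" for c'
    using that \<open>finite above\<close> by (metis Max_ge finite_imageI imageI)
  have "dominant c"
  proof (rule ccontr)
    assume "\<not> dominant c"
    then obtain i where neg: "coroot_eval A i c < 0" by (auto simp: dominant_def not_le)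
    then have "simple_refl A i c k \<ge> c k" for k by (simp add: simple_refl_def)
    then have "simple_refl A i c \<in> above"
      using c simple_refl_root_vecs by (auto simp: above_def intro: order_trans)
    then show False using max neg height_simple_refl by fastforce
  qed
  then show thesis using that c by (auto simp: above_def)
qed

end

locale simple_cartan = finite_cartan A for A :: "'n::{finite,linorder} \<Rightarrow> 'n \<Rightarrow> int" +
  assumes indecomposable: "indecomposable A"
begin

lemma dominant_root_full_support:
  assumes "t \<in> root_vecs" "dominant t"
  shows "t k > 0"
proof (rule ccontr)
  assume k: "\<not> t k > 0"
  note t_nonneg = dominant_root_nonneg[OF assms]
  define J where "J = {i. t i \<noteq> 0}"
  have "J \<noteq> {}" using root_vecs_nonzero[OF assms(1)] by (auto simp: J_def)
  moreover have "J \<noteq> UNIV" using k t_nonneg[of k] by (auto simp: J_def)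
  ultimately obtain i j where ij: "i \<in> J" "j \<notin> J" "A i j \<noteq> 0"
    using indecomposable unfolding indecomposable_def by metis
  have "(\<Sum>k\<in>UNIV. A j k * t k) < (\<Sum>k\<in>(UNIV :: 'n set). 0)"
  proof (rule sum_strict_mono_ex1)
    show "\<forall>k\<in>UNIV. A j k * t k \<le> 0"
    proof
      fix k show "A j k * t k \<le> 0"
        using fin.offdiag_nonpos[of j k] t_nonneg[of k] ij(2)
        by (cases "j = k") (auto simp: J_def mult_nonpos_nonneg)
    qed
    have "A j i < 0" using fin.offdiag_nonpos[of j i] fin.zero_sym[of i j] ij by (auto simp: less_le)
    moreover have "t i > 0" using t_nonneg[of i] ij by (auto simp: J_def less_le)
    ultimately show "\<exists>k\<in>UNIV. A j k * t k < 0" by (auto intro: mult_neg_pos)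
  qed simp
  then have "coroot_eval A j t < 0" by (simp add: coroot_eval_def)
  then show False using assms(2) by (auto simp: dominant_def not_le[symmetric])
qed

lemma dominant_roots_form_pos:
  assumes "f \<in> root_vecs" "dominant f" "g \<in> root_vecs" "dominant g"
  shows "form f g > 0"
proof -
  obtain i where i: "coroot_eval A i g > 0" using assms(3,4) by (rule dominant_root_pos_coroot)
  note f_pos = dominant_root_full_support[OF assms(1,2)]
  show ?thesis unfolding form_def
  proof (rule sum_pos2[of _ i])
    show "0 < real_of_int (f i) * symmetrizer i * real_of_int (coroot_eval A i g)"
      using f_pos symmetrizer_pos i by simp
    show "0 \<le> real_of_int (f i) * symmetrizer i * real_of_int (coroot_eval A i g)" for i
      using f_pos[of i] symmetrizer_pos[of i] assms(4) by (simp add: dominant_def)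
  qed auto
qed

lemma dominant_roots_comparable:
  assumes "f \<in> root_vecs" "dominant f" "g \<in> root_vecs" "dominant g"
  shows "(\<forall>k. f k \<le> g k) \<or> (\<forall>k. g k \<le> f k)"
proof (cases "f = g")
  case False
  then have "(\<lambda>x. f x - g x) \<in> root_vecs"
    using root_vecs_diff dominant_roots_form_pos assms by blast
  then show ?thesis using root_vecs_sign by fastforce
qed simp

lemma ex_highest_root_vec: "\<exists>t\<in>root_vecs. \<forall>b\<in>root_vecs. \<forall>k. b k \<le> t k"
proof -
  have "root_vecs \<noteq> {}" using simple_root_in_root_vecs by blast
  with finite_root_vecs obtain t where t: "t \<in> root_vecs" and "Max (height ` root_vecs) = height t"
    by (rule obtains_MAX)
  then have max: "height b \<le> height t" if "b \<in> root_vecs" for b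
    using that finite_root_vecs by (metis Max_ge finite_imageI imageI)
  have dominant_t: "dominant t"
    unfolding dominant_def using max[OF simple_refl_root_vecs[OF t]] by (simp add: height_simple_refl)
  have "b k \<le> t k" if b: "b \<in> root_vecs" for b k
  proof -
    obtain c where c: "c \<in> root_vecs" "dominant c" "\<And>k. b k \<le> c k"
      using ex_dominant_root_above[OF b] by blast
    have "c k \<le> t k"
      using dominant_roots_comparable[OF c(1,2) t dominant_t] height_strict_mono[of t c] max[OF c(1)]
      by fastforce
    then show ?thesis using c(3)[of k] by simp
  qed
  then show ?thesis using t by blast
qed

definition highest_vec :: "'n \<Rightarrow> int" where
  "highest_vec = (SOME t. t \<in> root_vecs \<and> (\<forall>b\<in>root_vecs. \<forall>k. b k \<le> t k))"

lemma highest_vec_in_root_vecs: "highest_vec \<in> root_vecs"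
  and le_highest_vec: "b \<in> root_vecs \<Longrightarrow> b k \<le> highest_vec k"
proof -
  have "\<exists>t. t \<in> root_vecs \<and> (\<forall>b\<in>root_vecs. \<forall>k. b k \<le> t k)"
    using ex_highest_root_vec by blast
  then have "highest_vec \<in> root_vecs \<and> (\<forall>b\<in>root_vecs. \<forall>k. b k \<le> highest_vec k)"
    unfolding highest_vec_def by (rule someI_ex)
  then show "highest_vec \<in> root_vecs" "b \<in> root_vecs \<Longrightarrow> b k \<le> highest_vec k" by auto
qed

lemma highest_root_eq: "highest_root A = root_weight highest_vec"
  unfolding highest_root_def
proof (rule the_equality)
  have top_iff: "(\<forall>\<beta>\<in>roots A. \<exists>c::'n \<Rightarrow> nat. root_weight f - \<beta> = (\<Sum>i\<in>UNIV. lsc (int (c i)) (alpha A i)))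
      \<longleftrightarrow> (\<forall>g\<in>root_vecs. \<forall>k. g k \<le> f k)" for f
    unfolding roots_eq by (simp add: root_weight_dominance)
  show "root_weight highest_vec \<in> roots A
      \<and> (\<forall>\<beta>\<in>roots A. \<exists>c. root_weight highest_vec - \<beta> = (\<Sum>i\<in>UNIV. lsc (int (c i)) (alpha A i)))"
    unfolding top_iff using highest_vec_in_root_vecs le_highest_vec roots_eq by auto
  fix t assume t: "t \<in> roots A \<and> (\<forall>\<beta>\<in>roots A. \<exists>c. t - \<beta> = (\<Sum>i\<in>UNIV. lsc (int (c i)) (alpha A i)))"
  then obtain f where f: "f \<in> root_vecs" "t = root_weight f" unfolding roots_eq by blast
  have "\<forall>g\<in>root_vecs. \<forall>k. g k \<le> f k" using t unfolding f(2) top_iff by blast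
  then have "f = highest_vec"
    using highest_vec_in_root_vecs le_highest_vec[OF f(1)] by (intro ext order_antisym) auto
  then show "t = root_weight highest_vec" using f(2) by simp
qed

section \<open>The affine Weyl group\<close>

subsection \<open>The affine Cartan matrix\<close>

lemma coroot_highest_root_word:
  obtains ws i where "highest_vec = word_act A ws (simple_root i)"
    "coroot A (highest_root A) = fst (snd (fin_word ws)) (unitv i)"
proof -
  have "highest_root A \<in> roots A" using highest_vec_in_root_vecs roots_eq highest_root_eq by auto
  then have "\<exists>c. \<exists>w\<in>weylW A. \<exists>i. fst w (alpha A i) = highest_root A \<and> fst (snd w) (unitv i) = c"
    unfolding roots_def by force
  then have "\<exists>w\<in>weylW A. \<exists>i. fst w (alpha A i) = highest_root A \<and> fst (snd w) (unitv i) = coroot A (highest_root A)"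
    unfolding coroot_def by (rule someI_ex)
  then obtain w i where "w \<in> weylW A" and wi: "fst w (alpha A i) = highest_root A"
    "fst (snd w) (unitv i) = coroot A (highest_root A)" by blast
  then obtain ws where w: "w = fin_word ws" using weylW_iff by blast
  have "highest_vec = word_act A ws (simple_root i)"
    using wi(1) fin_word_root_weight[of ws "simple_root i"]
    by (simp add: w root_weight_simple_root highest_root_eq root_weight_inject)
  then show thesis using that wi(2) by (simp add: w)
qed

lemma form_highest_vec:
  "2 * form highest_vec f = of_int (lpair (coroot A (highest_root A)) (root_weight f)) * form highest_vec highest_vec"
proof -
  obtain ws i where "highest_vec = word_act A ws (simple_root i)"
    and "coroot A (highest_root A) = fst (snd (fin_word ws)) (unitv i)" by (rule coroot_highest_root_word)
  then show ?thesis using form_root_eq[of highest_vec ws i f] lpair_word_coroot[of ws i f] by simp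
qed

lemma acoroot_aalpha: "lpair (acoroot A j) (aalpha A j) = 2"
proof (cases j)
  case None
  have "form highest_vec highest_vec > 0" using root_vecs_form_pos highest_vec_in_root_vecs by blast
  then show ?thesis using form_highest_vec[of highest_vec] None
    by (simp add: acoroot_def aalpha_def lpair_simps highest_root_eq)
qed (simp add: acoroot_def aalpha_def)

definition affine_cartan :: "'n option \<Rightarrow> 'n option \<Rightarrow> int" where
  "affine_cartan j k = lpair (acoroot A j) (aalpha A k)"

lemma affine_cartan_Some_Some: "affine_cartan (Some i) (Some k) = A i k"
  and affine_cartan_Some_None: "affine_cartan (Some i) None = - coroot_eval A i highest_vec"
  by (simp_all add: affine_cartan_def acoroot_def aalpha_def lpair_simps highest_root_eq)

lemma affine_cartan_None_Some:
  "of_int (affine_cartan None (Some i)) * form highest_vec highest_vec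
    = 2 * symmetrizer i * of_int (affine_cartan (Some i) None)"
  using form_highest_vec[of "simple_root i"]
  by (simp add: affine_cartan_Some_None form_simple_root_right root_weight_simple_root)
     (simp add: affine_cartan_def acoroot_def aalpha_def lpair_simps)

lemma dominant_highest_vec: "dominant highest_vec"
  unfolding dominant_def
proof
  fix i
  have "simple_refl A i highest_vec i \<le> highest_vec i"
    by (intro le_highest_vec simple_refl_root_vecs highest_vec_in_root_vecs)
  then show "coroot_eval A i highest_vec \<ge> 0" by (simp add: simple_refl_def)
qed

sublocale aff: generalized_cartan affine_cartan
proof
  fix j k :: "'n option"
  show "affine_cartan j j = 2" by (simp add: affine_cartan_def acoroot_aalpha)
  have form_highest_pos: "form highest_vec highest_vec > 0"
    using root_vecs_form_pos highest_vec_in_root_vecs by blast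
  have Some_None: "affine_cartan (Some i) None \<le> 0" for i
    using dominant_highest_vec by (simp add: affine_cartan_Some_None dominant_def)
  have None_Some: "affine_cartan None (Some i) \<le> 0"
    and zero_iff: "affine_cartan None (Some i) = 0 \<longleftrightarrow> affine_cartan (Some i) None = 0" for i
  proof -
    have "of_int (affine_cartan None (Some i)) * form highest_vec highest_vec \<le> 0"
      unfolding affine_cartan_None_Some using Some_None[of i] symmetrizer_pos[of i]
      by (intro mult_nonneg_nonpos) simp_all
    then show "affine_cartan None (Some i) \<le> 0" using form_highest_pos by (simp add: mult_le_0_iff)
    show "affine_cartan None (Some i) = 0 \<longleftrightarrow> affine_cartan (Some i) None = 0"
      using affine_cartan_None_Some[of i] form_highest_pos symmetrizer_pos[of i] by auto
  qed
  show "affine_cartan j k \<le> 0" if "j \<noteq> k"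
    using that fin.offdiag_nonpos Some_None None_Some
    by (cases j; cases k) (auto simp: affine_cartan_Some_Some)
  show "affine_cartan j k = 0 \<longleftrightarrow> affine_cartan k j = 0"
    using fin.zero_sym zero_iff by (cases j; cases k) (auto simp: affine_cartan_Some_Some)
qed

subsection \<open>Inverses\<close>

lemma agen_agen: "amult (agen A j) (agen A j) = aone"
proof (intro prod_eqI ext)
  show "fst (amult (agen A j) (agen A j)) l = fst aone l" for l
    by (rule poly_mapping_eqI) (simp add: fst_agen lpair_simps acoroot_aalpha lookup_minus)
  show "fst (snd (amult (agen A j) (agen A j))) m = fst (snd aone) m" for m
    by (rule poly_mapping_eqI) (simp add: fst_snd_agen lpair_simps acoroot_aalpha lookup_minus)
  show "snd (snd (amult (agen A j) (agen A j))) = snd (snd aone)"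
    using acoroot_aalpha[of None]
    by (intro poly_mapping_eqI) (simp add: fst_snd_agen snd_snd_agen lpair_simps lookup_minus lookup_add)
qed

lemma amult_agen_agen: "b \<in> affW A \<Longrightarrow> amult (amult b (agen A j)) (agen A j) = b"
  by (simp add: amult_assoc affW_lattice_linear agen_agen)

lemma agen_agen_amult: "amult (agen A j) (amult (agen A j) b) = b"
  by (simp add: amult_assoc[symmetric] lattice_linear_agen agen_agen)

lemma wordprod_rev: "amult (wordprod A (rev ws)) (wordprod A ws) = aone"
proof (induction ws)
  case (Cons j ws)
  then show ?case by (simp add: wordprod_snoc amult_assoc lattice_linear_wordprod agen_agen_amult)
qed simp

lemma wordprod_rev_right: "amult (wordprod A ws) (wordprod A (rev ws)) = aone"
  using wordprod_rev[of "rev ws"] by simp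

lemma affW_pairing:
  assumes "b \<in> affW A"
  shows "lpair (fst (snd b) m) (fst b l) = lpair m l"
proof -
  obtain ws where "b = wordprod A ws" using assms affW_iff by blast
  then show ?thesis using wordprod_pairing[of ws A] acoroot_aalpha by blast
qed

subsection \<open>Faithfulness of the action on root vectors\<close>

text \<open>The kernel of \<open>level_zero\<close> is spanned by the imaginary root; the coordinate at \<open>None\<close> records the
  level that is lost.\<close>

definition level_zero :: "('n option \<Rightarrow> int) \<Rightarrow> 'n lat" where
  "level_zero f = (\<Sum>k\<in>UNIV. lsc (f k) (aalpha A k))"

lemma lpair_level_zero: "lpair (acoroot A j) (level_zero f) = coroot_eval affine_cartan j f"
  by (simp add: level_zero_def lpair_sum_right lpair_lsc_right coroot_eval_def affine_cartan_def mult.commute)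

lemma lookup_level_zero:
  "Poly_Mapping.lookup (level_zero f) i = (\<Sum>k\<in>UNIV. Poly_Mapping.lookup (aalpha A k) i * f k)"
  by (simp add: level_zero_def lookup_sum mult.commute)

lemma level_zero_simple_root: "level_zero (simple_root k) = aalpha A k"
  by (rule poly_mapping_eqI)
     (simp add: lookup_level_zero simple_root_def if_distrib[of "\<lambda>x. _ * x"] cong: if_cong)

lemma agen_level_zero: "fst (agen A j) (level_zero f) = level_zero (simple_refl affine_cartan j f)"
  by (rule poly_mapping_eqI)
     (simp add: fst_agen lpair_level_zero lookup_minus lookup_level_zero simple_refl_def sum_fun_upd del: fun_upd_apply)

lemma wordprod_level_zero: "fst (wordprod A ws) (level_zero f) = level_zero (word_act affine_cartan ws f)"
  by (induction ws) (simp_all add: agen_level_zero)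

lemma word_act_None:
  "word_act affine_cartan ws f None
    = f None - lpair (snd (snd (wordprod A ws))) (fst (wordprod A ws) (level_zero f))"
proof (induction ws)
  case (Cons j ws)
  define g where "g = word_act affine_cartan ws f"
  have "lpair (snd (snd (agen A j))) (fst (agen A j) (level_zero g))
      = (if j = None then coroot_eval affine_cartan None g else 0)"
    using acoroot_aalpha[of None] by (simp add: snd_snd_agen fst_agen lpair_simps lpair_level_zero)
  moreover have "simple_refl affine_cartan j g None
      = g None - (if j = None then coroot_eval affine_cartan None g else 0)"
    by (simp add: simple_refl_def)
  ultimately show ?case using Cons affW_pairing[OF affW_agen[of A j]]
    by (simp add: wordprod_level_zero lpair_plus_left g_def[symmetric])
qed simp

lemma level_zero_None_inj:
  assumes "level_zero f = level_zero g" "f None = g None"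
  shows "f = g"
proof -
  have split: "level_zero h = root_weight (\<lambda>i. h (Some i)) + lsc (h None) (aalpha A None)" for h
    by (rule poly_mapping_eqI)
      (simp add: lookup_level_zero lookup_add UNIV_option_conv sum.reindex coroot_eval_def mult.commute aalpha_def[of _ "Some _"])
  have "(\<lambda>i. f (Some i)) = (\<lambda>i. g (Some i))"
    using assms unfolding split by (simp add: root_weight_inject)
  then show ?thesis using assms(2) by (metis (no_types) ext option.exhaust)
qed

lemma affW_eq_aoneI:
  assumes b: "b \<in> affW A" and fixes_alpha: "\<And>i. fst b (alpha A i) = alpha A i"
    and translation: "\<And>i. lpair (snd (snd b)) (alpha A i) = 0"
  shows "b = aone"
proof -
  have coweights: "fst (snd b) m = m" for m
  proof -
    have "lpair (fst (snd b) m - m) (alpha A i) = 0" for i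
      using affW_pairing[OF b, of m "alpha A i"] by (simp add: fixes_alpha lpair_minus_left)
    then show ?thesis using coweight_eq_0I by force
  qed
  have "fst b l = l" for l
  proof (rule poly_mapping_eqI)
    fix k show "Poly_Mapping.lookup (fst b l) k = Poly_Mapping.lookup l k"
      using affW_pairing[OF b, of "unitv k" l] by (simp add: coweights)
  qed
  moreover have "snd (snd b) = 0" using translation by (rule coweight_eq_0I)
  ultimately show ?thesis using coweights by (intro prod_eqI ext) simp_all
qed

lemma wordprod_eq_aone_iff: "wordprod A ws = aone \<longleftrightarrow> word_act affine_cartan ws = (\<lambda>f. f)"
proof
  assume "wordprod A ws = aone"
  then show "word_act affine_cartan ws = (\<lambda>f. f)"
    using wordprod_level_zero[of ws] word_act_None[of ws] by (intro ext level_zero_None_inj) simp_all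
next
  assume trivial: "word_act affine_cartan ws = (\<lambda>f. f)"
  have fixes_alpha: "fst (wordprod A ws) (alpha A i) = alpha A i" for i
    using wordprod_level_zero[of ws "simple_root (Some i)"] trivial by (simp add: level_zero_simple_root aalpha_def)
  then show "wordprod A ws = aone"
    using word_act_None[of ws "simple_root (Some _)"] trivial
    by (intro affW_eq_aoneI) (simp_all add: level_zero_simple_root aalpha_def)
qed

theorem wordprod_eq_iff: "wordprod A us = wordprod A vs \<longleftrightarrow> word_act affine_cartan us = word_act affine_cartan vs"
proof -
  have "wordprod A us = wordprod A vs \<longleftrightarrow> wordprod A (rev vs @ us) = aone"
  proof
    assume "wordprod A (rev vs @ us) = aone"
    then have "amult (wordprod A vs) (amult (wordprod A (rev vs)) (wordprod A us)) = wordprod A vs"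
      by (simp add: wordprod_append lattice_linear_wordprod)
    then show "wordprod A us = wordprod A vs"
      by (simp add: wordprod_rev_right amult_assoc[symmetric] lattice_linear_wordprod)
  qed (simp add: wordprod_append wordprod_rev)
  also have "\<dots> \<longleftrightarrow> word_act affine_cartan (rev vs @ us) = (\<lambda>f. f)" by (rule wordprod_eq_aone_iff)
  also have "\<dots> \<longleftrightarrow> word_act affine_cartan us = word_act affine_cartan vs"
  proof
    assume trivial: "word_act affine_cartan (rev vs @ us) = (\<lambda>f. f)"
    show "word_act affine_cartan us = word_act affine_cartan vs"
    proof
      fix f show "word_act affine_cartan us f = word_act affine_cartan vs f"
        using arg_cong[OF fun_cong[OF trivial, of f], of "word_act affine_cartan vs"] by simp
    qed
  qed (intro ext, simp)
  finally show ?thesis .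
qed

subsection \<open>Length\<close>

lemma len_wordprod: "len A (wordprod A ws) = aff.word_len ws"
  by (simp add: len_def aff.word_len_def wordprod_eq_iff)

lemma reduced_iff: "aff.reduced ws \<longleftrightarrow> len A (wordprod A ws) = length ws"
  by (simp add: aff.reduced_def len_wordprod)

lemma len_wordprod_le: "len A (wordprod A ws) \<le> length ws"
  unfolding len_wordprod by (rule aff.word_len_le_length)

lemma
  assumes "x \<in> affW A"
  shows wordprod_redword: "wordprod A (redword A x) = x"
    and length_redword: "length (redword A x) = len A x"
    and reduced_redword: "aff.reduced (redword A x)"
proof -
  obtain ws where ws: "x = wordprod A ws" using assms affW_iff by blast
  obtain us where "word_act affine_cartan us = word_act affine_cartan ws" "length us = aff.word_len ws"
    using aff.ex_reduced_word by blast
  then have "wordprod A us = x \<and> length us = len A x" by (simp add: ws len_wordprod wordprod_eq_iff)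
  then have "wordprod A (redword A x) = x \<and> length (redword A x) = len A x"
    unfolding redword_def by (rule someI)
  then show "wordprod A (redword A x) = x" "length (redword A x) = len A x" "aff.reduced (redword A x)"
    by (simp_all add: reduced_iff)
qed

lemma len_right_cases:
  assumes "v \<in> affW A"
  shows "len A (amult v (agen A j)) = Suc (len A v) \<or> Suc (len A (amult v (agen A j))) = len A v"
proof -
  obtain ws where "v = wordprod A ws" using assms affW_iff by blast
  then show ?thesis using aff.word_len_snoc_cases[of ws j] by (simp only: len_wordprod flip: wordprod_snoc)
qed

lemma len_left_cases:
  assumes "v \<in> affW A"
  shows "len A (amult (agen A j) v) = Suc (len A v) \<or> Suc (len A (amult (agen A j) v)) = len A v"
proof -
  obtain ws where "v = wordprod A ws" using assms affW_iff by blast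
  then show ?thesis using aff.word_len_Cons_cases[of j ws] by (simp only: len_wordprod flip: wordprod_Cons)
qed

lemma ex_right_descent:
  assumes "v \<in> affW A" "v \<noteq> aone"
  obtains j where "Suc (len A (amult v (agen A j))) = len A v"
proof -
  obtain ws where v: "v = wordprod A ws" using assms(1) affW_iff by blast
  have "length (redword A v) \<noteq> 0" using wordprod_redword[OF assms(1)] assms(2) by auto
  then have "len A v \<noteq> 0" unfolding length_redword[OF assms(1)] .
  then have "aff.word_len ws \<noteq> 0" by (simp add: v len_wordprod)
  then obtain j where "Suc (aff.word_len (ws @ [j])) = aff.word_len ws" by (rule aff.ex_right_descent)
  then show thesis using that by (simp only: v len_wordprod flip: wordprod_snoc)
qed

lemma finite_len_le: "finite {y \<in> affW A. len A y \<le> N}"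
proof -
  have "{y \<in> affW A. len A y \<le> N} \<subseteq> wordprod A ` {ws. set ws \<subseteq> UNIV \<and> length ws \<le> N}"
  proof
    fix y assume "y \<in> {y \<in> affW A. len A y \<le> N}"
    then have "redword A y \<in> {ws. set ws \<subseteq> UNIV \<and> length ws \<le> N}" "y = wordprod A (redword A y)"
      by (simp_all add: wordprod_redword length_redword)
    then show "y \<in> wordprod A ` {ws. set ws \<subseteq> UNIV \<and> length ws \<le> N}" by (rule rev_image_eqI)
  qed
  moreover have "finite {ws :: 'n option list. set ws \<subseteq> UNIV \<and> length ws \<le> N}"
    by (rule finite_lists_length_le) simp
  ultimately show ?thesis by (rule finite_subset[OF _ finite_imageI])
qed

subsection \<open>Semidirect product decomposition\<close>

definition finite_part :: "'n aff \<Rightarrow> 'n aff" where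
  "finite_part b = (fst b, fst (snd b), 0)"

definition translation_part :: "'n aff \<Rightarrow> 'n aff" where
  "translation_part b = (id, id, snd (snd b))"

lemma translation_part_finite_part: "amult (translation_part b) (finite_part b) = b"
  by (simp add: translation_part_def finite_part_def amult_def)

lemma finite_part_amult: "x \<in> affW A \<Longrightarrow> finite_part (amult x y) = amult (finite_part x) (finite_part y)"
  by (intro prod_eqI) (simp_all add: finite_part_def affW_lattice_linear lattice_linear_0)

lemma finite_part_fin_word: "finite_part (fin_word ws) = fin_word ws"
proof -
  have "snd (snd (fin_word ws)) = 0"
    by (induction ws) (simp_all add: snd_snd_agen lattice_linear_agen lattice_linear_0)
  then show ?thesis by (simp add: finite_part_def prod_eq_iff)
qed

lemma fin_word_rev_cancel:
  "fst (fin_word ws) (fst (fin_word (rev ws)) l) = l"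
  "fst (snd (fin_word ws)) (fst (snd (fin_word (rev ws))) m) = m"
proof -
  have inverse: "amult (fin_word ws) (fin_word (rev ws)) = aone"
    using wordprod_rev_right[of "map Some ws"] by (simp add: rev_map)
  show "fst (fin_word ws) (fst (fin_word (rev ws)) l) = l"
    using fun_cong[OF arg_cong[OF inverse, of fst], of l] by simp
  show "fst (snd (fin_word ws)) (fst (snd (fin_word (rev ws))) m) = m"
    using fun_cong[OF arg_cong[OF inverse, of "\<lambda>x. fst (snd x)"], of m] by simp
qed

lemma fin_word_conjugate_reflection:
  fixes ws i
  defines "\<beta> \<equiv> fst (fin_word ws) (alpha A i)" and "c \<equiv> fst (snd (fin_word ws)) (unitv i)"
    and "r \<equiv> fin_word (ws @ [i] @ rev ws)"
  shows "fst r l = l - lsc (lpair c l) \<beta>" "fst (snd r) m = m - lsc (lpair m \<beta>) c"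
proof -
  have "lpair (unitv i) (fst (fin_word (rev ws)) l) = lpair c l"
    using fin_word_pairing[of ws "unitv i" "fst (fin_word (rev ws)) l"] by (simp add: fin_word_rev_cancel c_def)
  then show "fst r l = l - lsc (lpair c l) \<beta>"
    by (simp add: r_def wordprod_append fst_agen acoroot_def aalpha_def lattice_linear_diff lattice_linear_lsc
        lattice_linear_wordprod fin_word_rev_cancel \<beta>_def)
  have "lpair (fst (snd (fin_word (rev ws))) m) (alpha A i) = lpair m \<beta>"
    using fin_word_pairing[of ws "fst (snd (fin_word (rev ws))) m" "alpha A i"] by (simp add: fin_word_rev_cancel \<beta>_def)
  then show "fst (snd r) m = m - lsc (lpair m \<beta>) c"
    by (simp add: r_def wordprod_append fst_snd_agen acoroot_def aalpha_def lattice_linear_diff lattice_linear_lsc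
        lattice_linear_wordprod fin_word_rev_cancel c_def)
qed

lemma finite_part_szero: "finite_part (szero A) \<in> weylW A"
proof -
  obtain ws i where highest: "highest_vec = word_act A ws (simple_root i)"
    and coroot: "coroot A (highest_root A) = fst (snd (fin_word ws)) (unitv i)" by (rule coroot_highest_root_word)
  have root: "fst (fin_word ws) (alpha A i) = highest_root A"
    using fin_word_root_weight[of ws "simple_root i"] by (simp add: root_weight_simple_root highest_root_eq highest)
  have "finite_part (szero A) = finite_part (fin_word (ws @ [i] @ rev ws))"
    using fin_word_conjugate_reflection[of ws i, unfolded root coroot[symmetric]]
    by (intro prod_eqI ext) (simp_all add: finite_part_def szero_def Let_def)
  then show ?thesis unfolding finite_part_fin_word weylW_iff by blast
qed

lemma finite_part_weylW:
  assumes "b \<in> affW A"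
  shows "finite_part b \<in> weylW A"
  using assms
proof (induction rule: affW.induct)
  case one
  show ?case by (simp add: finite_part_def weylW.one flip: aone_def)
next
  case (step w j)
  have "finite_part (agen A j) \<in> weylW A"
  proof (cases j)
    case None
    then show ?thesis using finite_part_szero by (simp add: agen_def)
  next
    case (Some i)
    then have "finite_part (agen A j) = fin_word [i]" using finite_part_fin_word[of "[i]"] by (simp add: wordprod_single del: wordprod_Cons)
    then show ?thesis unfolding weylW_iff by blast
  qed
  then show ?case using step by (simp add: finite_part_amult weylW_amult)
qed

lemma translation_part_affW:
  assumes "b \<in> affW A"
  shows "translation_part b \<in> affW A"
proof -
  obtain ws where ws: "finite_part b = fin_word ws" using finite_part_weylW[OF assms] weylW_iff by metis
  have "amult b (fin_word (rev ws)) = amult (translation_part b) (amult (finite_part b) (fin_word (rev ws)))"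
    by (subst translation_part_finite_part[of b, symmetric], rule amult_assoc)
       (simp add: translation_part_def lattice_linear_id)
  also have "\<dots> = translation_part b"
    unfolding ws using wordprod_rev_right[of "map Some ws"] by (simp add: rev_map translation_part_def lattice_linear_id)
  finally show ?thesis using assms affW_amult affW_wordprod by metis
qed

end

section \<open>Operators of the K-nilHecke ring\<close>

subsection \<open>Yang-Baxter identities\<close>

locale quadratic_operators =
  fixes T :: "'j \<Rightarrow> ('x \<Rightarrow> 'f::field) \<Rightarrow> 'x \<Rightarrow> 'f"
  assumes linear: "T j (\<lambda>x. p * f x + q * g x) = (\<lambda>x. p * T j f x + q * T j g x)"
    and square: "T j (T j f) = (\<lambda>x. - T j f x)"
begin

lemma add: "T j (\<lambda>x. f x + g x) = (\<lambda>x. T j f x + T j g x)"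
  using linear[of j 1 f 1 g] by simp

lemma diff: "T j (\<lambda>x. f x - g x) = (\<lambda>x. T j f x - T j g x)"
  using linear[of j 1 f "-1" g] by simp

lemma scaled: "T j (\<lambda>x. p * f x) = (\<lambda>x. p * T j f x)"
  using linear[of j p f 0 f] by simp

lemma uminus: "T j (\<lambda>x. - f x) = (\<lambda>x. - T j f x)"
  using scaled[of j "-1" f] by simp

lemma foldr_linear: "foldr T ws (\<lambda>x. p * f x + q * g x) = (\<lambda>x. p * foldr T ws f x + q * foldr T ws g x)"
  by (induction ws) (simp_all add: linear)

lemma foldr_uminus: "foldr T ws (\<lambda>x. - f x) = (\<lambda>x. - foldr T ws f x)"
  using foldr_linear[of ws "-1" f 0 f] by simp

lemma foldr_diff: "foldr T ws (\<lambda>x. f x - g x) = (\<lambda>x. foldr T ws f x - foldr T ws g x)"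
  using foldr_linear[of ws 1 f "-1" g] by simp

lemma foldr_zero: "foldr T ws (\<lambda>x. 0) = (\<lambda>x. 0)"
  using foldr_linear[of ws 0 undefined 0 undefined] by simp

lemma foldr_sum:
  assumes "finite S"
  shows "foldr T ws (\<lambda>x. \<Sum>y\<in>S. c y * g y x) = (\<lambda>x. \<Sum>y\<in>S. c y * foldr T ws (g y) x)"
  using assms
proof (induction S rule: finite_induct)
  case empty
  show ?case by (simp add: foldr_zero)
next
  case (insert y S)
  then show ?case using foldr_linear[of ws "c y" "g y" 1 "\<lambda>x. \<Sum>y\<in>S. c y * g y x"] by simp
qed

fun step_word :: "'j list \<Rightarrow> 'f list \<Rightarrow> ('x \<Rightarrow> 'f) \<Rightarrow> 'x \<Rightarrow> 'f" where
  "step_word (j # ws) (a # as) f = (\<lambda>x. step_word ws as f x + (1 - a) * T j (step_word ws as f) x)"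
| "step_word _ _ f = f"

text \<open>The factors \<open>1 + (1 - a) T\<^sub>j\<close> satisfy the Yang-Baxter equation as soon as the \<open>T\<^sub>j\<close> satisfy the braid
  relation: all words but the longest ones cancel.\<close>

definition yang_baxter :: "'j list \<Rightarrow> 'f list \<Rightarrow> 'j list \<Rightarrow> 'f list \<Rightarrow> bool" where
  "yang_baxter us as vs bs \<longleftrightarrow> (\<forall>f x. step_word us as f x - step_word vs bs f x
    = (\<Prod>a\<leftarrow>as. 1 - a) * (foldr T us f x - foldr T vs f x))"

lemma yang_baxter_2: "yang_baxter [i, j] [X, Y] [j, i] [Y, X]"
  unfolding yang_baxter_def by (simp add: add scaled, algebra)

lemma yang_baxter_3: "yang_baxter [i, j, i] [X, X * Y, Y] [j, i, j] [Y, X * Y, X]"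
  unfolding yang_baxter_def by (simp add: add diff scaled uminus square, algebra)

lemma yang_baxter_4:
  "yang_baxter [i, j, i, j] [X, X * Y, X * Y^2, Y] [j, i, j, i] [Y, X * Y^2, X * Y, X]"
  unfolding yang_baxter_def by (simp add: add diff scaled uminus square, algebra)

lemma yang_baxter_6:
  "yang_baxter [i, j, i, j, i, j] [X, X * Y, X^2 * Y^3, X * Y^2, X * Y^3, Y]
    [j, i, j, i, j, i] [Y, X * Y^3, X * Y^2, X^2 * Y^3, X * Y, X]"
  unfolding yang_baxter_def by (simp add: add diff scaled uminus square, algebra)

end

subsection \<open>Characters\<close>

lemma fr_1 [simp]: "fr 1 = 1"
  by (simp add: fr_def One_fract_def)

lemma fr_diff: "fr (x - y) = fr x - fr y"
  by (simp add: fr_def)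

lemma fr_mult: "fr (x * y) = fr x * fr y"
  by (simp add: fr_def)

lemma fr_eq_iff: "fr x = fr y \<longleftrightarrow> x = y"
  by (simp add: fr_def eq_fract)

lemma echar_add: "echar (x + y) = echar x * echar y"
  by (simp add: echar_def mult_single)

lemma echar_0 [simp]: "echar 0 = 1"
  by (simp add: echar_def)

lemma echar_eq_1_iff: "echar x = 1 \<longleftrightarrow> x = 0"
proof
  assume "echar x = 1"
  then have "Poly_Mapping.lookup (echar x) x = Poly_Mapping.lookup (echar 0) x" by simp
  then show "x = 0" unfolding echar_def lookup_single by (auto simp: when_def split: if_splits)
qed simp

lemma fr_echar_nonzero: "fr (echar x) \<noteq> 0"
proof -
  have "fr (echar x) * fr (echar (- x)) = 1" by (simp flip: fr_mult echar_add)
  then show ?thesis by auto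
qed

lemma fr_echar_diff: "fr (echar (x - y)) = fr (echar x) / fr (echar y)"
proof -
  have "fr (echar (x - y)) * fr (echar y) = fr (echar x)" by (simp flip: fr_mult echar_add)
  then show ?thesis by (simp add: nonzero_eq_divide_eq fr_echar_nonzero)
qed

lemma fr_echar_lsc: "fr (echar (lsc c x)) = fr (echar x) powi c"
proof (induction c rule: int_induct[where k = 0])
  case base
  have "lsc 0 x = 0" by (rule poly_mapping_eqI) simp
  then show ?case by simp
next
  case (step1 c)
  have "lsc (c + 1) x = lsc c x + x" by (rule poly_mapping_eqI) (simp add: lookup_add algebra_simps)
  then show ?case using step1 by (simp add: echar_add fr_mult power_int_add_1 fr_echar_nonzero)
next
  case (step2 c)
  have "lsc (c - 1) x = lsc c x - x" by (rule poly_mapping_eqI) (simp add: lookup_minus algebra_simps)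
  then show ?case using step2 by (simp add: fr_echar_diff power_int_diff fr_echar_nonzero)
qed

context simple_cartan
begin

definition root_char :: "'n aff \<Rightarrow> 'n option \<Rightarrow> 'n frac" where
  "root_char b j = fr (echar (fst b (aalpha A j)))"

lemma root_char_nonzero: "root_char b j \<noteq> 0"
  unfolding root_char_def by (rule fr_echar_nonzero)

lemma root_char_ne_1:
  assumes "b \<in> affW A"
  shows "root_char b j \<noteq> 1"
proof
  assume "root_char b j = 1"
  then have "fst b (aalpha A j) = 0"
    using fr_eq_iff[of "echar (fst b (aalpha A j))" 1] by (simp add: root_char_def echar_eq_1_iff)
  then show False using affW_pairing[OF assms, of "acoroot A j" "aalpha A j"] acoroot_aalpha[of j]
    by (simp add: lpair_def)
qed

lemma root_char_amult_agen:
  assumes "b \<in> affW A"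
  shows "root_char (amult b (agen A j)) k = root_char b k * root_char b j powi (- affine_cartan j k)"
proof -
  note linear = affW_lattice_linear(1)[OF assms]
  have "fst (amult b (agen A j)) (aalpha A k)
      = fst b (aalpha A k) + lsc (- affine_cartan j k) (fst b (aalpha A j))"
    by (rule poly_mapping_eqI)
      (simp add: fst_agen affine_cartan_def lattice_linear_diff[OF linear] lattice_linear_lsc[OF linear] lookup_add lookup_minus)
  then show ?thesis by (simp add: root_char_def echar_add fr_mult fr_echar_lsc)
qed

fun root_chars :: "'n aff \<Rightarrow> 'n option list \<Rightarrow> 'n frac list" where
  "root_chars b [] = []"
| "root_chars b (j # ws) = root_char b j # root_chars (amult b (agen A j)) ws"

lemma root_chars_ne_1: "b \<in> affW A \<Longrightarrow> a \<in> set (root_chars b ws) \<Longrightarrow> a \<noteq> 1"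
proof (induction ws arbitrary: b)
  case (Cons j ws)
  have "amult b (agen A j) \<in> affW A" using Cons.prems(1) by (simp add: affW_amult)
  note tail = Cons.IH[OF this]
  have "a = root_char b j \<or> a \<in> set (root_chars (amult b (agen A j)) ws)" using Cons.prems(2) by simp
  then show ?case using tail root_char_ne_1[OF Cons.prems(1), of j] by metis
qed simp

definition leading_denom :: "'n aff \<Rightarrow> 'n option list \<Rightarrow> 'n frac" where
  "leading_denom b ws = (\<Prod>a\<leftarrow>root_chars b ws. 1 - a)"

lemma leading_denom_nonzero: "b \<in> affW A \<Longrightarrow> leading_denom b ws \<noteq> 0"
  using root_chars_ne_1[of b 1 ws] by (auto simp: leading_denom_def prod_list_zero_iff)

subsection \<open>Action on functions on the affine Weyl group\<close>

text \<open>Restricted to the affine Weyl group, because elsewhere the denominator of \<open>Tact\<close> may vanish and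
  the braid relations may fail.\<close>

definition T_op :: "'n option \<Rightarrow> ('n aff \<Rightarrow> 'n frac) \<Rightarrow> 'n aff \<Rightarrow> 'n frac" where
  "T_op j f b = (if b \<in> affW A then Tact A j f b else 0)"

lemma T_op_eq: "b \<in> affW A \<Longrightarrow> T_op j f b = (f (amult b (agen A j)) - f b) / (1 - root_char b j)"
  by (simp add: T_op_def Tact_def root_char_def fr_diff)

lemma T_op_outside: "b \<notin> affW A \<Longrightarrow> T_op j f b = 0"
  by (simp add: T_op_def)

lemma amult_agen_expansion: "b \<in> affW A \<Longrightarrow> f (amult b (agen A j)) = f b + (1 - root_char b j) * T_op j f b"
  using root_char_ne_1[of b j] by (simp add: T_op_eq)

lemma T_op_linear: "T_op j (\<lambda>x. p * f x + q * g x) = (\<lambda>x. p * T_op j f x + q * T_op j g x)"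
proof
  fix b show "T_op j (\<lambda>x. p * f x + q * g x) b = p * T_op j f b + q * T_op j g b"
    using root_char_ne_1[of b j]
    by (cases "b \<in> affW A") (simp_all add: T_op_eq T_op_outside divide_simps, simp add: algebra_simps)
qed

lemma T_op_T_op: "T_op j (T_op j f) = (\<lambda>x. - T_op j f x)"
proof
  fix b show "T_op j (T_op j f) b = - T_op j f b"
  proof (cases "b \<in> affW A")
    case True
    define t where "t = T_op j f b"
    have "root_char (amult b (agen A j)) j = 1 / root_char b j"
      unfolding root_char_amult_agen[OF True] using root_char_nonzero[of b j]
      by (simp add: power_int_minus power2_eq_square field_simps)
    then have "T_op j f (amult b (agen A j)) = (f b - f (amult b (agen A j))) / (1 - 1 / root_char b j)"
      using True by (simp add: T_op_eq amult_agen_agen affW_amult)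
    also have "\<dots> = root_char b j * t"
      unfolding amult_agen_expansion[OF True, of f j] t_def[symmetric]
      using root_char_ne_1[OF True, of j] root_char_nonzero[of b j] by (simp add: field_simps)
    finally have "T_op j (T_op j f) b = (root_char b j * t - t) / (1 - root_char b j)"
      using T_op_eq[OF True, of j "T_op j f"] by (simp add: t_def)
    also have "\<dots> = - t" using root_char_ne_1[OF True, of j] by (simp add: field_simps)
    finally show ?thesis by (simp add: t_def)
  qed (simp add: T_op_outside)
qed

sublocale T: quadratic_operators T_op
  by standard (rule T_op_linear, rule T_op_T_op)

lemma amult_wordprod_expansion:
  assumes "b \<in> affW A"
  shows "f (amult b (wordprod A ws)) = T.step_word ws (root_chars b ws) f b"
  using assms
proof (induction ws arbitrary: b)
  case Nil
  then show ?case by (simp add: affW_lattice_linear)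
next
  case (Cons j ws)
  have "f (amult b (wordprod A (j # ws))) = f (amult (amult b (agen A j)) (wordprod A ws))"
    using Cons.prems by (simp add: amult_assoc affW_lattice_linear)
  also have "\<dots> = T.step_word ws (root_chars (amult b (agen A j)) ws) f (amult b (agen A j))"
    using Cons by (simp add: affW_amult)
  also have "\<dots> = T.step_word (j # ws) (root_chars b (j # ws)) f b"
    using amult_agen_expansion[OF Cons.prems] by simp
  finally show ?case .
qed

subsection \<open>Independence of the reduced word\<close>

text \<open>The two sides expand \<open>f (b w) = f (b w')\<close> for the two reduced words of the same element.\<close>

lemma yang_baxter_imp_braid:
  assumes "b \<in> affW A" "wordprod A us = wordprod A vs"
    and "T.yang_baxter us (root_chars b us) vs (root_chars b vs)"
  shows "foldr T_op us f b = foldr T_op vs f b"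
proof -
  have "T.step_word us (root_chars b us) f b - T.step_word vs (root_chars b vs) f b = 0"
    using assms(2) by (simp flip: amult_wordprod_expansion[OF assms(1)])
  then have "leading_denom b us * (foldr T_op us f b - foldr T_op vs f b) = 0"
    using assms(3) unfolding T.yang_baxter_def leading_denom_def by metis
  then show ?thesis using leading_denom_nonzero[OF assms(1)] by simp
qed

lemma yang_baxter_root_chars:
  assumes "b \<in> affW A" "(affine_cartan i j, affine_cartan j i) \<in> {(0,0), (-1,-1), (-1,-2), (-1,-3)}"
  defines "m \<equiv> aff.braid_order i j"
  shows "T.yang_baxter (alt i j m) (root_chars b (alt i j m)) (alt j i m) (root_chars b (alt j i m))"
proof -
  define X Y where "X = root_char b i" and "Y = root_char b j"
  have nonzero: "X \<noteq> 0" "Y \<noteq> 0" by (simp_all add: X_def Y_def root_char_nonzero)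
  have root_char_step: "root_char (amult c (agen A k)) l = root_char c l * root_char c k powi (- affine_cartan k l)"
    "amult c (agen A k) \<in> affW A" if "c \<in> affW A" for c k l
    using that by (simp_all add: root_char_amult_agen affW_amult)
  note eval_root_chars = root_char_step assms(1) X_def[symmetric] Y_def[symmetric] nonzero power_int_minus
    eval_nat_numeral field_simps
  consider (A1_A1) "affine_cartan i j = 0" "affine_cartan j i = 0"
    | (A2) "affine_cartan i j = -1" "affine_cartan j i = -1"
    | (B2) "affine_cartan i j = -1" "affine_cartan j i = -2"
    | (G2) "affine_cartan i j = -1" "affine_cartan j i = -3"
    using assms(2) by auto
  then show ?thesis
  proof cases
    case A1_A1
    then have "root_chars b [i, j] = [X, Y]" "root_chars b [j, i] = [Y, X]" "m = 2"
      by (simp_all add: eval_root_chars m_def aff.braid_order_def)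
    then show ?thesis using T.yang_baxter_2[of i j X Y] by (simp add: eval_nat_numeral)
  next
    case A2
    then have "root_chars b [i, j, i] = [X, X * Y, Y]" "root_chars b [j, i, j] = [Y, X * Y, X]" "m = 3"
      by (simp_all add: eval_root_chars m_def aff.braid_order_def)
    then show ?thesis using T.yang_baxter_3[of i j X Y] by (simp add: eval_nat_numeral)
  next
    case B2
    then have "root_chars b [i, j, i, j] = [X, X * Y, X * Y^2, Y]"
      "root_chars b [j, i, j, i] = [Y, X * Y^2, X * Y, X]" "m = 4"
      by (simp_all add: eval_root_chars m_def aff.braid_order_def)
    then show ?thesis using T.yang_baxter_4[of i j X Y] by (simp add: eval_nat_numeral)
  next
    case G2
    then have "root_chars b [i, j, i, j, i, j] = [X, X * Y, X^2 * Y^3, X * Y^2, X * Y^3, Y]"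
      "root_chars b [j, i, j, i, j, i] = [Y, X * Y^3, X * Y^2, X^2 * Y^3, X * Y, X]" "m = 6"
      by (simp_all add: eval_root_chars m_def aff.braid_order_def)
    then show ?thesis using T.yang_baxter_6[of i j X Y] by (simp add: eval_nat_numeral)
  qed
qed

lemma T_op_braid:
  assumes "i \<noteq> j"
  shows "foldr T_op (alt i j (aff.braid_order i j)) = foldr T_op (alt j i (aff.braid_order i j))"
proof (cases "aff.braid_order i j = 0")
  case False
  have braid_at: "foldr T_op (alt i j (aff.braid_order i j)) f b = foldr T_op (alt j i (aff.braid_order i j)) f b"
    if "b \<in> affW A" "i \<noteq> j"
      "(affine_cartan i j, affine_cartan j i) \<in> {(0,0), (-1,-1), (-1,-2), (-1,-3)}" for i j f b
    using that
    by (intro yang_baxter_imp_braid yang_baxter_root_chars) (simp_all add: wordprod_eq_iff aff.word_act_braid[OF that(2)])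
  have outside: "foldr T_op (alt k l (aff.braid_order i j)) f b = 0" if "b \<notin> affW A" for k l f b
    using False that by (cases "aff.braid_order i j") (simp_all add: T_op_outside)
  show ?thesis
  proof (intro ext)
    fix f b
    show "foldr T_op (alt i j (aff.braid_order i j)) f b = foldr T_op (alt j i (aff.braid_order i j)) f b"
      using aff.finite_braid_order_cases[OF assms False] outside[of b i j f] outside[of b j i f]
        braid_at[of b i j f] braid_at[of b j i f] assms aff.braid_order_sym[of i j] by (cases "b \<in> affW A") auto
  qed
qed simp

definition T_elem :: "'n aff \<Rightarrow> ('n aff \<Rightarrow> 'n frac) \<Rightarrow> 'n aff \<Rightarrow> 'n frac" where
  "T_elem v = foldr T_op (redword A v)"

theorem foldr_T_op_reduced: "aff.reduced ws \<Longrightarrow> foldr T_op ws = T_elem (wordprod A ws)"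
  unfolding T_elem_def
  by (rule aff.matsumoto[OF T_op_braid _ reduced_redword])
     (simp_all add: wordprod_redword flip: wordprod_eq_iff)

lemma T_elem_aone: "T_elem aone f = f"
  using foldr_T_op_reduced[of "[]"] by (simp add: reduced_iff len_wordprod_le[of "[]", simplified])

lemma T_elem_T_op_ascent:
  assumes "v \<in> affW A" "len A (amult v (agen A j)) = Suc (len A v)"
  shows "T_elem v (T_op j f) = T_elem (amult v (agen A j)) f"
proof -
  have snoc: "wordprod A (redword A v @ [j]) = amult v (agen A j)"
    by (simp add: wordprod_snoc wordprod_redword assms(1))
  then have "foldr T_op (redword A v @ [j]) = T_elem (amult v (agen A j))"
    using foldr_T_op_reduced[of "redword A v @ [j]"] assms by (simp add: reduced_iff length_redword)
  from fun_cong[OF this, of f] show ?thesis by (simp add: T_elem_def)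
qed

lemma T_elem_T_op_descent:
  assumes "v \<in> affW A" "Suc (len A (amult v (agen A j))) = len A v"
  shows "T_elem v (T_op j f) = (\<lambda>x. - T_elem v f x)"
proof -
  define w where "w = amult v (agen A j)"
  have w: "w \<in> affW A" "amult w (agen A j) = v"
    using assms(1) by (simp_all add: affW_amult amult_agen_agen w_def)
  have ascent: "T_elem w (T_op j g) = T_elem v g" for g
    using T_elem_T_op_ascent[OF w(1), of j g] assms(2) w(2) by (simp add: w_def)
  show ?thesis unfolding ascent[symmetric] T_op_T_op by (simp add: T_elem_def T.foldr_uminus)
qed

lemma T_op_T_elem_ascent:
  assumes "v \<in> affW A" "len A (amult (agen A j) v) = Suc (len A v)"
  shows "T_op j (T_elem v f) = T_elem (amult (agen A j) v) f"
proof -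
  have "foldr T_op (j # redword A v) = T_elem (amult (agen A j) v)"
    using foldr_T_op_reduced[of "j # redword A v"] assms by (simp add: reduced_iff wordprod_redword length_redword)
  from fun_cong[OF this, of f] show ?thesis by (simp add: T_elem_def)
qed

lemma T_op_T_elem_descent:
  assumes "v \<in> affW A" "Suc (len A (amult (agen A j) v)) = len A v"
  shows "T_op j (T_elem v f) = (\<lambda>x. - T_elem v f x)"
proof -
  define w where "w = amult (agen A j) v"
  have w: "w \<in> affW A" "amult (agen A j) w = v"
    using assms(1) by (simp_all add: affW_amult agen_agen_amult w_def)
  have ascent: "T_op j (T_elem w f) = T_elem v f"
    using T_op_T_elem_ascent[OF w(1), of j f] assms(2) w(2) by (simp add: w_def)
  show ?thesis unfolding ascent[symmetric] T_op_T_op ..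
qed

section \<open>The Schubert basis\<close>

subsection \<open>Triangularity and duality\<close>

lemma pairT_eq: "pairT A v f = T_elem v f aone"
proof -
  have "b \<in> affW A \<Longrightarrow> foldr (Tact A) ws f b = foldr T_op ws f b" for ws b
  proof (induction ws arbitrary: b)
    case (Cons j ws)
    then show ?case by (simp add: T_op_def Tact_def affW_amult)
  qed simp
  then show ?thesis by (simp add: pairT_def T_elem_def)
qed

lemma pairT_diff: "pairT A v (\<lambda>x. f x - g x) = pairT A v f - pairT A v g"
  by (simp add: pairT_eq T_elem_def T.foldr_diff)

lemma pairT_zero: "pairT A v (\<lambda>x. 0) = 0"
  by (simp add: pairT_eq T_elem_def T.foldr_zero)

lemma foldr_T_op_leading:
  assumes "b \<in> affW A" "\<And>us. length us < length ws \<Longrightarrow> f (amult b (wordprod A us)) = 0"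
  shows "foldr T_op ws f b = f (amult b (wordprod A ws)) / leading_denom b ws"
  using assms
proof (induction ws arbitrary: b)
  case Nil
  then show ?case by (simp add: affW_lattice_linear leading_denom_def)
next
  case (Cons j ws)
  have assoc: "amult (amult b (agen A j)) x = amult b (amult (agen A j) x)" for x
    using Cons.prems(1) by (simp add: amult_assoc affW_lattice_linear)
  have "foldr T_op ws f b = 0"
    using Cons.IH[OF Cons.prems(1)] Cons.prems(2) by simp
  moreover have "foldr T_op ws f (amult b (agen A j))
      = f (amult b (wordprod A (j # ws))) / leading_denom (amult b (agen A j)) ws"
    using Cons.IH[of "amult b (agen A j)"] Cons.prems(1) Cons.prems(2)[of "j # _"] by (simp add: assoc affW_amult)
  ultimately show ?case by (simp add: T_op_eq[OF Cons.prems(1)] leading_denom_def)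
qed

lemma pairT_leading:
  assumes "v \<in> affW A" "\<And>x. x \<in> affW A \<Longrightarrow> len A x < len A v \<Longrightarrow> f x = 0"
  shows "pairT A v f = f v / leading_denom aone (redword A v)"
proof -
  have "f (wordprod A us) = 0" if "length us < length (redword A v)" for us
    using that assms len_wordprod_le[of us] by (simp add: length_redword)
  then show ?thesis
    using foldr_T_op_leading[OF affW_aone, of "redword A v" f] assms(1)
    by (simp add: pairT_eq T_elem_def wordprod_redword)
qed

lemma pairT_zero_imp_zero:
  assumes "\<And>v. v \<in> affW A \<Longrightarrow> len A v \<le> N \<Longrightarrow> pairT A v f = 0" "v \<in> affW A" "len A v \<le> N"
  shows "f v = 0"
  using assms(2,3)
proof (induction "len A v" arbitrary: v rule: less_induct)
  case less
  then have "pairT A v f = f v / leading_denom aone (redword A v)" by (intro pairT_leading) auto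
  then show ?case using assms(1) less.prems leading_denom_nonzero[OF affW_aone] by simp
qed

lemma pairT_eqI:
  assumes "\<And>b. b \<notin> affW A \<Longrightarrow> f b = g b" "\<And>v. v \<in> affW A \<Longrightarrow> pairT A v f = pairT A v g"
  shows "f = g"
proof
  fix b show "f b = g b"
  proof (cases "b \<in> affW A")
    case True
    have "f b - g b = 0"
      using assms(2) True by (intro pairT_zero_imp_zero[of "len A b" "\<lambda>x. f x - g x" b]) (simp_all add: pairT_diff)
    then show ?thesis by simp
  qed (simp add: assms(1))
qed

definition is_dual :: "'n aff \<Rightarrow> ('n aff \<Rightarrow> 'n frac) \<Rightarrow> bool" where
  "is_dual w f \<longleftrightarrow> (\<forall>b. b \<notin> affW A \<longrightarrow> f b = 0) \<and> (\<forall>v\<in>affW A. pairT A v f = (if v = w then 1 else 0))"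

text \<open>The value at \<open>v\<close> is the one that \<open>pairT_leading\<close> forces, given the values at shorter elements.\<close>

function dual_fun :: "'n aff \<Rightarrow> 'n aff \<Rightarrow> 'n frac" where
  "dual_fun w v = (if v \<in> affW A
     then ((if v = w then 1 else 0) - pairT A v (\<lambda>x. if len A x < len A v then dual_fun w x else 0))
       * leading_denom aone (redword A v)
     else 0)"
  by pat_completeness auto
termination by (relation "measure (\<lambda>(w, v). len A v)") auto

declare dual_fun.simps [simp del]

lemma is_dual_dual_fun: "is_dual w (dual_fun w)"
proof -
  have "pairT A v (dual_fun w) = (if v = w then 1 else 0)" if v: "v \<in> affW A" for v
  proof -
    define shorter where "shorter = (\<lambda>x. if len A x < len A v then dual_fun w x else 0)"
    have "pairT A v (\<lambda>x. dual_fun w x - shorter x)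
        = (dual_fun w v - shorter v) / leading_denom aone (redword A v)"
      by (rule pairT_leading[OF v]) (simp add: shorter_def)
    also have "\<dots> = (if v = w then 1 else 0) - pairT A v shorter"
      using v leading_denom_nonzero[OF affW_aone] by (simp add: dual_fun.simps[of w v] shorter_def)
    finally show ?thesis by (simp add: pairT_diff)
  qed
  then show ?thesis by (simp add: is_dual_def dual_fun.simps)
qed

lemma is_dual_schub: "is_dual w (schub A w)"
proof -
  have "schub A w = dual_fun w" unfolding schub_def is_dual_def[symmetric]
  proof (rule the_equality)
    show "is_dual w (dual_fun w)" by (rule is_dual_dual_fun)
    show "g = dual_fun w" if "is_dual w g" for g
      using that is_dual_dual_fun[of w] unfolding is_dual_def by (intro pairT_eqI) metis+
  qed
  then show ?thesis by (simp add: is_dual_dual_fun)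
qed

lemma schub_outside: "b \<notin> affW A \<Longrightarrow> schub A w b = 0"
  using is_dual_schub unfolding is_dual_def by blast

lemma pairT_schub: "v \<in> affW A \<Longrightarrow> pairT A v (schub A w) = (if v = w then 1 else 0)"
  using is_dual_schub by (simp add: is_dual_def)

theorem schubert_expansion:
  assumes "v \<in> affW A" "len A v \<le> N"
  shows "f v = (\<Sum>y\<in>{y \<in> affW A. len A y \<le> N}. pairT A y f * schub A y v)"
proof -
  define S where "S = {y \<in> affW A. len A y \<le> N}"
  have fin: "finite S" unfolding S_def by (rule finite_len_le)
  have "f v - (\<Sum>y\<in>S. pairT A y f * schub A y v) = 0"
  proof (rule pairT_zero_imp_zero[of N "\<lambda>v. f v - (\<Sum>y\<in>S. pairT A y f * schub A y v)"])
    fix x assume x: "x \<in> affW A" "len A x \<le> N"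
    have "pairT A x (\<lambda>v. \<Sum>y\<in>S. pairT A y f * schub A y v) = (\<Sum>y\<in>S. pairT A y f * pairT A x (schub A y))"
      unfolding pairT_eq[of x] T_elem_def T.foldr_sum[OF fin] ..
    also have "\<dots> = (\<Sum>y\<in>S. if x = y then pairT A y f else 0)"
      by (intro sum.cong) (auto simp: pairT_schub x)
    also have "\<dots> = pairT A x f" using fin x by (simp add: S_def)
    finally show "pairT A x (\<lambda>v. f v - (\<Sum>y\<in>S. pairT A y f * schub A y v)) = 0" by (simp add: pairT_diff)
  qed (use assms in auto)
  then show ?thesis by (simp add: S_def)
qed

subsection \<open>The operators on the Schubert basis\<close>

lemma pairT_T_op_schub:
  assumes "v \<in> affW A"
  shows "pairT A v (T_op j (schub A u)) =
    (if len A v < len A (amult v (agen A j)) then if amult v (agen A j) = u then 1 else 0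
     else - (if v = u then 1 else 0))"
proof (cases "len A (amult v (agen A j)) = Suc (len A v)")
  case True
  then show ?thesis using T_elem_T_op_ascent[OF assms True, of "schub A u"] pairT_schub[of "amult v (agen A j)" u] assms
    by (simp add: pairT_eq affW_amult)
next
  case False
  then have descent: "Suc (len A (amult v (agen A j))) = len A v" using len_right_cases[OF assms] by blast
  then show ?thesis using T_elem_T_op_descent[OF assms descent, of "schub A u"] pairT_schub[OF assms, of u]
    by (simp add: pairT_eq)
qed

lemma T_op_schub_ascent:
  assumes "u \<in> affW A" "len A u < len A (amult u (agen A j))"
  shows "T_op j (schub A u) = (\<lambda>b. 0)"
proof (rule pairT_eqI)
  fix v assume v: "v \<in> affW A"
  have "\<not> len A v < len A u" if "amult v (agen A j) = u"
    using assms(2) amult_agen_agen[OF v, of j] that by simp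
  then show "pairT A v (T_op j (schub A u)) = pairT A v (\<lambda>b. 0)"
    using assms(2) by (auto simp: pairT_T_op_schub[OF v] pairT_zero)
qed (simp add: T_op_outside)

lemma T_op_schub_descent:
  assumes "u \<in> affW A" "len A (amult u (agen A j)) < len A u"
  shows "T_op j (schub A u) = (\<lambda>b. schub A (amult u (agen A j)) b - schub A u b)"
proof (rule pairT_eqI)
  fix v assume v: "v \<in> affW A"
  have "amult v (agen A j) = u \<longleftrightarrow> v = amult u (agen A j)"
    using amult_agen_agen[OF v, of j] amult_agen_agen[OF assms(1), of j] by metis
  then show "pairT A v (T_op j (schub A u)) = pairT A v (\<lambda>b. schub A (amult u (agen A j)) b - schub A u b)"
    using assms(2) by (auto simp: pairT_T_op_schub[OF v] pairT_diff pairT_schub[OF v])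
qed (simp add: T_op_outside schub_outside)

lemma schub_aone: "y \<noteq> aone \<Longrightarrow> schub A y aone = 0"
  using pairT_schub[OF affW_aone, of y] by (simp add: pairT_eq T_elem_aone)

lemma schub_weylW_zero:
  assumes "v \<in> weylW A" "y \<in> affW A" "y \<notin> weylW A"
  shows "schub A y v = 0"
  using assms
proof (induction arbitrary: y rule: weylW.induct)
  case one
  then have "y \<noteq> aone" using weylW.one by auto
  then show ?case by (rule schub_aone)
next
  case (step w i)
  have w: "w \<in> affW A" using step.hyps weylW_subset_affW by blast
  have sgen: "sgen A i = agen A (Some i)" by (simp add: agen_def)
  define ys where "ys = amult y (agen A (Some i))"
  have ys: "ys \<in> affW A" using step.prems by (simp add: affW_amult ys_def)
  have "amult ys (sgen A i) = y" using step.prems by (simp add: sgen ys_def amult_agen_agen)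
  then have "ys \<notin> weylW A" using weylW.step[of ys A i] step.prems by auto
  then have zero: "schub A y w = 0" "schub A ys w = 0" using step.IH step.prems ys by auto
  consider (ascent) "len A y < len A ys" | (descent) "len A ys < len A y"
    using len_right_cases[OF step.prems(1), of "Some i"] unfolding ys_def by linarith
  then have "T_op (Some i) (schub A y) w = 0"
  proof cases
    case ascent
    then show ?thesis using T_op_schub_ascent[OF step.prems(1), of "Some i"] by (simp add: ys_def)
  next
    case descent
    then show ?thesis using T_op_schub_descent[OF step.prems(1), of "Some i"] zero by (simp add: ys_def)
  qed
  then show ?case using amult_agen_expansion[OF w, of "schub A y" "Some i"] zero by (simp add: sgen)
qed

section \<open>Demazure products\<close>

definition demazure_step :: "'n option \<Rightarrow> 'n aff \<Rightarrow> 'n aff" where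
  "demazure_step j v = (if len A v < len A (amult (agen A j) v) then amult (agen A j) v else v)"

lemma demazure_eq: "demazure A x y = foldr demazure_step (redword A x) y"
  unfolding demazure_def demazure_step_def[abs_def] ..

lemma foldr_demazure_step_affW: "y \<in> affW A \<Longrightarrow> foldr demazure_step ws y \<in> affW A"
  by (induction ws) (simp_all add: demazure_step_def affW_amult)

lemma len_le_foldr_demazure_step: "len A y \<le> len A (foldr demazure_step ws y)"
proof (induction ws)
  case (Cons j ws)
  have "len A z \<le> len A (demazure_step j z)" for z by (simp add: demazure_step_def)
  from order_trans[OF Cons this] show ?case by simp
qed simp

lemma T_op_T_elem:
  assumes "z \<in> affW A"
  shows "T_op j (T_elem z f) = (\<lambda>b. (- 1) ^ Suc (len A z + len A (demazure_step j z)) * T_elem (demazure_step j z) f b)"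
proof (cases "len A (amult (agen A j) z) = Suc (len A z)")
  case True
  then show ?thesis using T_op_T_elem_ascent[OF assms True, of f] by (simp add: demazure_step_def)
next
  case False
  then have descent: "Suc (len A (amult (agen A j) z)) = len A z" using len_left_cases[OF assms] by blast
  then show ?thesis using T_op_T_elem_descent[OF assms descent, of f] by (simp add: demazure_step_def)
qed

lemma foldr_T_op_T_elem:
  assumes "y \<in> affW A"
  shows "foldr T_op ws (T_elem y f)
    = (\<lambda>b. (- 1) ^ (length ws + len A y + len A (foldr demazure_step ws y)) * T_elem (foldr demazure_step ws y) f b)"
proof (induction ws)
  case Nil
  show ?case by (simp flip: mult_2)
next
  case (Cons j ws)
  define z where "z = foldr demazure_step ws y"
  have z: "z \<in> affW A" unfolding z_def using assms by (rule foldr_demazure_step_affW)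
  have "foldr T_op (j # ws) (T_elem y f)
      = (\<lambda>b. (- 1) ^ (length ws + len A y + len A z) * T_op j (T_elem z f) b)"
    by (simp add: Cons T.scaled flip: z_def)
  also have "\<dots> = (\<lambda>b. (- 1) ^ (length (j # ws) + len A y + len A (demazure_step j z)) * T_elem (demazure_step j z) f b)"
    unfolding T_op_T_elem[OF z] by (simp add: mult.assoc[symmetric] power_add[symmetric] fun_eq_iff)
      (simp add: power_add)
  finally show ?case by (simp add: z_def)
qed

lemma demazure_affW: "y \<in> affW A \<Longrightarrow> demazure A x y \<in> affW A"
  unfolding demazure_eq by (rule foldr_demazure_step_affW)

theorem T_elem_T_elem:
  assumes "x \<in> affW A" "y \<in> affW A"
  shows "T_elem x (T_elem y f)
    = (\<lambda>b. (- 1) ^ (len A x + len A y + len A (demazure A x y)) * T_elem (demazure A x y) f b)"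
  using foldr_T_op_T_elem[OF assms(2), of "redword A x" f] length_redword[OF assms(1)]
  by (simp add: demazure_eq T_elem_def[of x])

lemma len_right_le_demazure: "len A y \<le> len A (demazure A x y)"
  unfolding demazure_eq by (rule len_le_foldr_demazure_step)

lemma T_elem_foldr_T_op:
  assumes "x \<in> affW A"
  shows "\<exists>r\<in>affW A. len A x \<le> len A r \<and> (\<exists>s. \<forall>f b. T_elem x (foldr T_op ws f) b = s * T_elem r f b)"
  using assms
proof (induction ws arbitrary: x)
  case Nil
  then show ?case by (intro bexI[of _ x] conjI exI[of _ 1]) simp_all
next
  case (Cons j ws)
  consider (ascent) "len A (amult x (agen A j)) = Suc (len A x)" | (descent) "Suc (len A (amult x (agen A j))) = len A x"
    using len_right_cases[OF Cons.prems] by blast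
  then show ?case
  proof cases
    case ascent
    obtain r s where "r \<in> affW A" "len A (amult x (agen A j)) \<le> len A r"
      "\<And>f b. T_elem (amult x (agen A j)) (foldr T_op ws f) b = s * T_elem r f b"
      using Cons.IH[of "amult x (agen A j)"] Cons.prems affW_amult affW_agen by blast
    then show ?thesis using ascent T_elem_T_op_ascent[OF Cons.prems ascent]
      by (intro bexI[of _ r] conjI exI[of _ s]) simp_all
  next
    case descent
    obtain r s where "r \<in> affW A" "len A x \<le> len A r" "\<And>f b. T_elem x (foldr T_op ws f) b = s * T_elem r f b"
      using Cons.IH[OF Cons.prems] by blast
    then show ?thesis using T_elem_T_op_descent[OF Cons.prems descent]
      by (intro bexI[of _ r] conjI exI[of _ "- s"]) simp_all
  qed
qed

text \<open>Multiplying \<open>T\<^sub>x\<close> by \<open>T\<^sub>y\<close> on the right, letter by letter, never shortens the index \<open>x\<close>, and the Schubert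
  basis tells that the index reached is \<open>x * y\<close>.\<close>

lemma len_left_le_demazure:
  assumes "x \<in> affW A" "y \<in> affW A"
  shows "len A x \<le> len A (demazure A x y)"
proof -
  define z where "z = demazure A x y"
  have z: "z \<in> affW A" unfolding z_def using assms(2) by (rule demazure_affW)
  obtain r s where r: "r \<in> affW A" "len A x \<le> len A r"
    "\<And>f b. T_elem x (T_elem y f) b = s * T_elem r f b"
    using T_elem_foldr_T_op[OF assms(1)] unfolding T_elem_def[of y] by blast
  have "s * pairT A r (schub A z) = (- 1) ^ (len A x + len A y + len A z) * pairT A z (schub A z)"
    using r(3)[of "schub A z" aone] unfolding pairT_eq T_elem_T_elem[OF assms] z_def by simp
  then have "pairT A r (schub A z) \<noteq> 0" using pairT_schub[OF z, of z] by auto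
  then have "r = z" using pairT_schub[OF r(1), of z] by (auto split: if_splits)
  then show ?thesis using r(2) by (simp add: z_def)
qed

subsection \<open>Factoring off a translation\<close>

definition demazure_coeff :: "'n aff \<Rightarrow> 'n aff \<Rightarrow> 'n aff \<Rightarrow> 'n frac" where
  "demazure_coeff x y w = (if demazure A x y = w then (- 1) ^ (len A x + len A y + len A w) else 0)"

lemma pairT_T_elem_schub:
  assumes "x \<in> affW A" "y \<in> affW A"
  shows "pairT A x (T_elem y (schub A w)) = demazure_coeff x y w"
proof -
  have "pairT A x (T_elem y (schub A w))
      = (- 1) ^ (len A x + len A y + len A (demazure A x y)) * pairT A (demazure A x y) (schub A w)"
    by (simp add: pairT_eq T_elem_T_elem[OF assms])
  then show ?thesis using pairT_schub[OF demazure_affW[OF assms(2)], of x w] by (simp add: demazure_coeff_def)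
qed

lemma foldr_T_op_translate:
  assumes "t \<in> affW A" "fst t = id" "x \<in> affW A"
  shows "foldr T_op ws (\<lambda>x. f (amult t x)) x = foldr T_op ws f (amult t x)"
  using assms(3)
proof (induction ws arbitrary: x)
  case (Cons j ws)
  have "root_char (amult t x) j = root_char x j" by (simp add: root_char_def assms(2))
  then show ?case using Cons assms(1) by (simp add: T_op_eq affW_amult amult_assoc affW_lattice_linear)
qed simp

lemma schub_translate_sum:
  assumes t: "t \<in> affW A" "fst t = id" "len A t \<le> N" and v: "v \<in> affW A" "len A v \<le> N"
  defines "S \<equiv> {y \<in> affW A. len A y \<le> N}"
  shows "schub A w (amult t v) = (\<Sum>(x, y)\<in>S \<times> S. demazure_coeff x y w * schub A x t * schub A y v)"
proof -
  have coeff: "pairT A y (\<lambda>x. schub A w (amult t x)) = (\<Sum>x\<in>S. demazure_coeff x y w * schub A x t)" if y: "y \<in> S" for y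
  proof -
    have "pairT A y (\<lambda>x. schub A w (amult t x)) = T_elem y (schub A w) t"
      using foldr_T_op_translate[OF t(1,2) affW_aone, of "redword A y"] t(1) by (simp add: pairT_eq T_elem_def affW_lattice_linear)
    also have "\<dots> = (\<Sum>x\<in>S. pairT A x (T_elem y (schub A w)) * schub A x t)"
      unfolding S_def by (rule schubert_expansion) (use t in simp_all)
    also have "\<dots> = (\<Sum>x\<in>S. demazure_coeff x y w * schub A x t)"
      using y by (intro sum.cong refl) (simp add: S_def pairT_T_elem_schub)
    finally show ?thesis .
  qed
  have "schub A w (amult t v) = (\<Sum>y\<in>S. pairT A y (\<lambda>x. schub A w (amult t x)) * schub A y v)"
    unfolding S_def by (rule schubert_expansion[of v N "\<lambda>x. schub A w (amult t x)"]) (use v in simp_all)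
  also have "\<dots> = (\<Sum>y\<in>S. \<Sum>x\<in>S. demazure_coeff x y w * schub A x t * schub A y v)"
    by (intro sum.cong refl) (simp add: coeff sum_distrib_right)
  also have "\<dots> = (\<Sum>x\<in>S. \<Sum>y\<in>S. demazure_coeff x y w * schub A x t * schub A y v)" by (rule sum.swap)
  finally show ?thesis by (simp add: sum.cartesian_product)
qed

definition demazure_factors :: "'n aff \<Rightarrow> ('n aff \<times> 'n aff) set" where
  "demazure_factors w = {(x, y). x \<in> affW A \<and> y \<in> weylW A \<and> demazure A x y = w}"

lemma demazure_factors_cases:
  assumes "p \<in> demazure_factors w"
  obtains x y where "p = (x, y)" "x \<in> affW A" "y \<in> weylW A" "demazure A x y = w"
  using assms unfolding demazure_factors_def by blast

lemma demazure_factors_subset: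
  assumes "len A w \<le> N"
  shows "demazure_factors w \<subseteq> {x \<in> affW A. len A x \<le> N} \<times> {y \<in> affW A. len A y \<le> N}"
proof
  fix p assume "p \<in> demazure_factors w"
  then obtain x y where p: "p = (x, y)" "x \<in> affW A" "y \<in> weylW A" "demazure A x y = w"
    by (rule demazure_factors_cases)
  then have "y \<in> affW A" using weylW_subset_affW by blast
  then show "p \<in> {x \<in> affW A. len A x \<le> N} \<times> {y \<in> affW A. len A y \<le> N}"
    using p assms len_left_le_demazure[of x y] len_right_le_demazure[of y x] by simp
qed

lemma demazure_coeff_schub_outside:
  assumes "v \<in> weylW A" "x \<in> affW A" "y \<in> affW A" "(x, y) \<notin> demazure_factors w"
  shows "demazure_coeff x y w * schub A y v = 0"
proof (cases "y \<in> weylW A")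
  case True
  then have "demazure A x y \<noteq> w" using assms by (simp add: demazure_factors_def)
  then show ?thesis by (simp add: demazure_coeff_def)
next
  case False
  then show ?thesis using schub_weylW_zero assms(1,3) by simp
qed

theorem schub_translation_formula:
  assumes t: "t \<in> affW A" "fst t = id" and v: "v \<in> weylW A"
  shows "schub A w (amult t v)
    = (\<Sum>(x, y)\<in>demazure_factors w. (- 1) ^ (len A x + len A y + len A w) * schub A x t * schub A y v)"
proof -
  define N where "N = len A t + len A v + len A w"
  define S where "S = {y \<in> affW A. len A y \<le> N}"
  have vW: "v \<in> affW A" using v weylW_subset_affW by blast
  have subset: "demazure_factors w \<subseteq> S \<times> S" unfolding S_def by (rule demazure_factors_subset) (simp add: N_def)
  have "schub A w (amult t v) = (\<Sum>(x, y)\<in>S \<times> S. demazure_coeff x y w * schub A x t * schub A y v)"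
    unfolding S_def by (rule schub_translate_sum) (simp_all add: t vW N_def)
  also have "\<dots> = (\<Sum>(x, y)\<in>demazure_factors w. demazure_coeff x y w * schub A x t * schub A y v)"
  proof (rule sum.mono_neutral_right[OF _ subset])
    show "finite (S \<times> S)" unfolding S_def by (intro finite_cartesian_product finite_len_le)
    show "\<forall>p\<in>S \<times> S - demazure_factors w. (case p of (x, y) \<Rightarrow> demazure_coeff x y w * schub A x t * schub A y v) = 0"
    proof
      fix p assume "p \<in> S \<times> S - demazure_factors w"
      moreover obtain x y where "p = (x, y)" by (rule prod.exhaust)
      ultimately show "(case p of (x, y) \<Rightarrow> demazure_coeff x y w * schub A x t * schub A y v) = 0"
        using demazure_coeff_schub_outside[OF v, of x y w] by (auto simp: S_def)
    qed
  qed
  also have "\<dots> = (\<Sum>(x, y)\<in>demazure_factors w. (- 1) ^ (len A x + len A y + len A w) * schub A x t * schub A y v)"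
  proof (rule sum.cong[OF refl])
    fix p assume "p \<in> demazure_factors w"
    then obtain x y where "p = (x, y)" "demazure A x y = w" by (rule demazure_factors_cases)
    then show "(case p of (x, y) \<Rightarrow> demazure_coeff x y w * schub A x t * schub A y v)
        = (case p of (x, y) \<Rightarrow> (- 1) ^ (len A x + len A y + len A w) * schub A x t * schub A y v)"
      by (simp add: demazure_coeff_def)
  qed
  finally show ?thesis .
qed

end

section \<open>Actions on Schubert classes\<close>

lemma actR_echar: "actR b (echar l) = echar (fst b l)"
  by (simp add: actR_def echar_def)

lemma actR_one_minus_echar:
  assumes "lattice_linear (fst b)"
  shows "actR b (1 - echar l) = 1 - echar (fst b l)"
proof (cases "l = 0")
  case True
  then show ?thesis using lattice_linear_0[OF assms] by (simp add: actR_def)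
next
  case False
  have lookup: "Poly_Mapping.lookup (1 - echar l) k = (if k = 0 then 1 else if k = l then -1 else 0)" for k
    using False by (auto simp: lookup_minus echar_def lookup_one lookup_single when_def)
  have "Poly_Mapping.keys (1 - echar l) = {0, l}"
    by (auto simp: in_keys_iff lookup set_eq_iff False split: if_splits)
  then have "actR b (1 - echar l) = Poly_Mapping.single (fst b 0) 1 + Poly_Mapping.single (fst b l) (- 1)"
    unfolding actR_def using False by (simp add: lookup)
  then show ?thesis using lattice_linear_0[OF assms] by (simp add: echar_def single_uminus)
qed

lemma eact_echar: "eact (echar la) f b = lineb la b * f b"
  by (simp add: eact_def lineb_def actR_echar)

lemma etaOp_eact:
  assumes "lattice_linear (fst b)"
  shows "etaOp (eact (1 - echar l) f) b = (1 - fr (echar (fst b l))) * etaOp f b"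
  using assms by (simp add: etaOp_def eact_def actR_one_minus_echar fr_diff)

lemma powi_diff_sign:
  assumes "Suc d = c"
  shows "(- 1 :: 'f::field) powi (int a + int b - int c - 1) = (- 1) ^ (a + b + d)"
  using assms[symmetric]
  by (cases "even a"; cases "even b"; cases "even d") (simp_all add: power_int_minus_left minus_one_power_iff)

context simple_cartan
begin

lemma yact_eq: "b \<in> affW A \<Longrightarrow> yact A j f b = f b + T_op j f b"
  by (simp add: yact_def T_op_def)

lemma sact_eq: "b \<in> affW A \<Longrightarrow> sact A j f b = f b + (1 - root_char b j) * T_op j f b"
  unfolding sact_def by (rule amult_agen_expansion)

lemma schub_ascent_invariant:
  assumes "u \<in> affW A" "len A u < len A (amult u (agen A j))" "b \<in> affW A"
  shows "yact A j (schub A u) b = schub A u b" "sact A j (schub A u) b = schub A u b"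
  by (simp_all add: yact_eq sact_eq assms(3) T_op_schub_ascent[OF assms(1,2)])

lemma yact_schub_descent:
  assumes "u \<in> affW A" "len A (amult u (agen A j)) < len A u" "b \<in> affW A"
  shows "yact A j (schub A u) b = schub A (amult u (agen A j)) b"
  by (simp add: yact_eq assms(3) T_op_schub_descent[OF assms(1,2)])

lemma sact_schub_descent:
  assumes "u \<in> affW A" "len A (amult u (agen A j)) < len A u" "b \<in> affW A"
  shows "sact A j (schub A u) b
    = eact (echar (aalpha A j)) (schub A u) b + (1 - root_char b j) * schub A (amult u (agen A j)) b"
proof -
  have "eact (echar (aalpha A j)) (schub A u) b = root_char b j * schub A u b"
    by (simp add: eact_def actR_echar root_char_def)
  then show ?thesis by (simp add: sact_eq assms(3) T_op_schub_descent[OF assms(1,2)] algebra_simps)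
qed

theorem schub_theta_eta:
  assumes "b \<in> affW A"
  shows "schub A w b
    = (\<Sum>(x, y)\<in>demazure_factors w. (- 1) ^ (len A x + len A y + len A w) * thetaOp (schub A x) b * etaOp (schub A y) b)"
proof -
  have "thetaOp f b = f (translation_part b)" "etaOp f b = f (finite_part b)" for f
    by (simp_all add: thetaOp_def etaOp_def translation_part_def finite_part_def)
  moreover have "fst (translation_part b) = id" by (simp add: translation_part_def)
  ultimately show ?thesis
    using schub_translation_formula[OF translation_part_affW[OF assms] _ finite_part_weylW[OF assms], of w]
    by (simp add: translation_part_finite_part)
qed

lemma schub_theta_eta_eact:
  assumes "b \<in> affW A"
  shows "(\<Sum>(x, y)\<in>demazure_factors w. (- 1) ^ (len A x + len A y + len A w) * thetaOp (schub A x) b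
      * etaOp (eact (1 - echar l) (schub A y)) b) = (1 - fr (echar (fst b l))) * schub A w b"
  unfolding schub_theta_eta[OF assms, of w] etaOp_eact[OF affW_lattice_linear(1)[OF assms]] sum_distrib_left
  by (intro sum.cong) auto

lemma affW0_ascent:
  assumes "u \<in> affW0 A"
  shows "len A u < len A (amult u (agen A (Some i)))"
proof -
  have u: "u \<in> affW A" "\<And>w. w \<in> weylW A \<Longrightarrow> len A u \<le> len A (amult u w)" using assms by (auto simp: affW0_def)
  have "agen A (Some i) \<in> weylW A" using weylW.step[OF weylW.one, of A i] by (simp add: agen_def)
  then have "len A u \<le> len A (amult u (agen A (Some i)))" by (rule u(2))
  then show ?thesis using len_right_cases[OF u(1), of "Some i"] by linarith
qed

lemma affW0_descent:
  assumes "u \<in> affW0 A" "u \<noteq> aone"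
  shows "Suc (len A (amult u (agen A None))) = len A u"
proof -
  have "u \<in> affW A" using assms(1) by (simp add: affW0_def)
  then obtain j where j: "Suc (len A (amult u (agen A j))) = len A u" using assms(2) by (rule ex_right_descent)
  show ?thesis
  proof (cases j)
    case None
    then show ?thesis using j by simp
  next
    case (Some i)
    then show ?thesis using j affW0_ascent[OF assms(1), of i] by simp
  qed
qed

end

theorem theorem4p15:
  fixes A :: "'n::{finite,linorder} \<Rightarrow> 'n \<Rightarrow> int" and la :: "'n lat" and u :: "'n aff"
  assumes "cartan_finite A" and "indecomposable A" and "u \<in> affW0 A"
  shows "(\<forall>b\<in>affW A. eact (echar la) (schub A u) b = lineb la b * schub A u b)
    \<and> (\<forall>i. \<forall>b\<in>affW A. yact A (Some i) (schub A u) b = schub A u b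
                      \<and> sact A (Some i) (schub A u) b = schub A u b)
    \<and> (u \<noteq> aone \<longrightarrow> (\<forall>b\<in>affW A.
          yact A None (schub A u) b = schub A (amult u (szero A)) b
        \<and> schub A (amult u (szero A)) b =
            (\<Sum>(x1, x2)\<in>{(x1, x2). x1 \<in> affW A \<and> x2 \<in> weylW A \<and> demazure A x1 x2 = amult u (szero A)}.
               (- 1) powi (int (len A x1) + int (len A x2) - int (len A u) - 1)
               * thetaOp (schub A x1) b * etaOp (schub A x2) b)))
    \<and> (u \<noteq> aone \<longrightarrow> (\<forall>b\<in>affW A.
          sact A None (schub A u) b =
            eact (echar (- highest_root A)) (schub A u) b
          + (\<Sum>(x1, x2)\<in>{(x1, x2). x1 \<in> affW A \<and> x2 \<in> weylW A \<and> demazure A x1 x2 = amult u (szero A)}.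
               (- 1) powi (int (len A x1) + int (len A x2) - int (len A u) - 1)
               * thetaOp (schub A x1) b
               * etaOp (eact (1 - echar (- highest_root A)) (schub A x2)) b)))"
proof -
  interpret simple_cartan A by standard (fact assms)+
  define w where "w = amult u (szero A)"
  have u: "u \<in> affW A" and w: "amult u (agen A None) = w" using assms(3) by (simp_all add: affW0_def w_def agen_def)
  have invariant: "yact A (Some i) (schub A u) b = schub A u b" "sact A (Some i) (schub A u) b = schub A u b"
    if "b \<in> affW A" for i b
    using schub_ascent_invariant[OF u affW0_ascent[OF assms(3)] that] .
  show ?thesis
  proof (cases "u = aone")
    case True
    then show ?thesis using invariant by (simp add: eact_echar)
  next
    case False
    then have descent: "Suc (len A w) = len A u" using affW0_descent[OF assms(3)] w by simp
    show ?thesis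
      unfolding w_def[symmetric] demazure_factors_def[symmetric] powi_diff_sign[OF descent]
      using invariant yact_schub_descent[OF u, of None] sact_schub_descent[OF u, of None] w descent
      by (simp add: eact_echar schub_theta_eta_eact root_char_def aalpha_def flip: schub_theta_eta)
  qed
qed

end
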